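(* Assume (A1)–(A3). Let $\alpha^*\in I$ and $s\geq0$. Take an arbitrary $\alpha_s\in(\underline{\alpha},\alpha^* )$ and set $T:=T(\alpha_s,\alpha^* )$. Then for any $u_s\in B_{\alpha_s}$ there exists a function $u:[s,s+T)\to B_{\alpha^*}$ such that: (1) $u$ is continuous on $[s,s+T)$ and continuously differentiable on $(s,s+T)$ (as a $B_{\alpha^*}$-valued function); (2) for every $t\in(s,s+T)$, $Au(t)\in B_{\alpha^*}$ and $Zu(t)\in B_{\alpha^*}$; (3) $\frac{d}{dt}u(t)=Au(t)+Zu(t)$ in $B_{\alpha^*}$ for all $t\in(s,s+T)$; (4) $u(s)=u_s$.
   Context: Standing assumptions (A1)–(A3): (A1) Fix $\underline{\alpha}>0$, $\overline{\alpha}\in(0,\infty]$ and set $I=(\underline{\alpha},\overline{\alpha})$. $(B_\alpha,\lVert\cdot\rVert_\alpha)_{\alpha\in I}$ is a family of Banach spaces such that for $\alpha'\le\alpha''$ in $I$: $B_{\alpha'}\subset B_{\alpha''}$ and $\lVert u\rVert_{\alpha'}\ge\lVert u\rVert_{\alpha''}$ for $u\in B_{\alpha'}$; moreover, if $u\in B_{\alpha'}$ and $u=0$ in $B_{\alpha''}$ then $u=0$ in $B_{\alpha'}$. Put $B_I:=\bigcup_{\alpha\in I}B_\alpha$. (A2) For each $\alpha\in I$ there are a closed linear subspace $C_\alpha\subset B_\alpha$ and a dense (in $C_\alpha$) linear subspace $D_\alpha\subset C_\alpha$. $A:B_I\to B_I$ is linear and, for each $\alpha\in I$, $(A,D_\alpha)$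 is the generator of a $C_0$-semigroup $S_\alpha(t)$ on $(C_\alpha,\lVert\cdot\rVert_\alpha)$. For all $\alpha'<\alpha$ in $I$: $B_{\alpha'}\subset D_\alpha$, $B_{\alpha'}$ is $S_\alpha(t)$-invariant, and $S_\alpha(t)\restriction_{B_{\alpha'}}=S_{\alpha'}(t)$. There are constants $\nu\ge1$, $\omega\in\mathbb{R}$, independent of $\alpha$, with $\lVert S_\alpha(t)\rVert\le\nu e^{\omega t}$ for all $t\ge0$, $\alpha\in I$. (A3) $M,N:I\to(0,\infty)$ are increasing continuous functions, and $Z:B_I\to B_I$ is linear such that for any $\alpha^*\in I$ and any $\alpha',\alpha''\in(\underline{\alpha},\alpha^*]$ with $\alpha'<\alpha''$, $Z$ maps $B_{\alpha'}$ boundedly into $B_{\alpha''}$ with $\lVert Zu\rVert_{\alpha''}\le\bigl(\frac{M(\alpha^* )}{\alpha''-\alpha'}+N(\alpha^* )\bigr)\lVert u\rVert_{\alpha'}$ for $u\in B_{\alpha'}$. Define $T(\alpha,\beta):=\dfrac{\beta-\alpha}{e\,\nu\,M(\beta)}$ for $\beta\ge\alpha>\underline{\alpha}$. *)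

theory Defs
  imports "HOL-Analysis.Analysis"
begin

text \<open>All spaces B(alpha) are modelled as subsets of one ambient real vector space 'v,
  each carrying its own norm nrm alpha. Convergence with respect to such a norm:\<close>

definition tends_in :: "('v::real_vector \<Rightarrow> real) \<Rightarrow> ('a \<Rightarrow> 'v) \<Rightarrow> 'v \<Rightarrow> 'a filter \<Rightarrow> bool" where
  "tends_in n f L F \<longleftrightarrow> (\<forall>e>0. eventually (\<lambda>x. n (f x - L) < e) F)"

definition subspace_on :: "'v::real_vector set \<Rightarrow> bool" where
  "subspace_on X \<longleftrightarrow> 0 \<in> X \<and> (\<forall>x\<in>X. \<forall>y\<in>X. x + y \<in> X) \<and> (\<forall>c. \<forall>x\<in>X. c *\<^sub>R x \<in> X)"

definition norm_on :: "'v::real_vector set \<Rightarrow> ('v \<Rightarrow> real) \<Rightarrow> bool" where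
  "norm_on X n \<longleftrightarrow> (\<forall>x\<in>X. n x \<ge> 0 \<and> (n x = 0 \<longleftrightarrow> x = 0))
     \<and> (\<forall>x\<in>X. \<forall>y\<in>X. n (x + y) \<le> n x + n y)
     \<and> (\<forall>c. \<forall>x\<in>X. n (c *\<^sub>R x) = \<bar>c\<bar> * n x)"

definition complete_wrt :: "'v::real_vector set \<Rightarrow> ('v \<Rightarrow> real) \<Rightarrow> bool" where
  "complete_wrt X n \<longleftrightarrow> (\<forall>f::nat \<Rightarrow> 'v. (\<forall>k. f k \<in> X) \<longrightarrow>
      (\<forall>e>0. \<exists>K. \<forall>i\<ge>K. \<forall>j\<ge>K. n (f i - f j) < e) \<longrightarrow>
      (\<exists>L\<in>X. tends_in n f L sequentially))"

definition banach_on :: "'v::real_vector set \<Rightarrow> ('v \<Rightarrow> real) \<Rightarrow> bool" where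
  "banach_on X n \<longleftrightarrow> subspace_on X \<and> norm_on X n \<and> complete_wrt X n"

definition linear_on :: "'v::real_vector set \<Rightarrow> ('v \<Rightarrow> 'v) \<Rightarrow> bool" where
  "linear_on X f \<longleftrightarrow> (\<forall>x\<in>X. \<forall>y\<in>X. f (x + y) = f x + f y) \<and> (\<forall>c. \<forall>x\<in>X. f (c *\<^sub>R x) = c *\<^sub>R f x)"

definition closed_subspace_in :: "'v::real_vector set \<Rightarrow> ('v \<Rightarrow> real) \<Rightarrow> 'v set \<Rightarrow> bool" where
  "closed_subspace_in X n C \<longleftrightarrow> C \<subseteq> X \<and> subspace_on C \<and>
     (\<forall>f::nat \<Rightarrow> 'v. \<forall>L\<in>X. (\<forall>k. f k \<in> C) \<longrightarrow> tends_in n f L sequentially \<longrightarrow> L \<in> C)"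

definition dense_in :: "('v::real_vector \<Rightarrow> real) \<Rightarrow> 'v set \<Rightarrow> 'v set \<Rightarrow> bool" where
  "dense_in n D C \<longleftrightarrow> (\<forall>x\<in>C. \<forall>e>0. \<exists>y\<in>D. n (x - y) < e)"

definition C0_semigroup :: "'v::real_vector set \<Rightarrow> ('v \<Rightarrow> real) \<Rightarrow> (real \<Rightarrow> 'v \<Rightarrow> 'v) \<Rightarrow> bool" where
  "C0_semigroup C n S \<longleftrightarrow>
     (\<forall>t\<ge>0. (\<forall>x\<in>C. S t x \<in> C) \<and> linear_on C (S t) \<and> (\<exists>K. \<forall>x\<in>C. n (S t x) \<le> K * n x))
   \<and> (\<forall>x\<in>C. S 0 x = x)
   \<and> (\<forall>t\<ge>0. \<forall>r\<ge>0. \<forall>x\<in>C. S (t + r) x = S t (S r x))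
   \<and> (\<forall>x\<in>C. tends_in n (\<lambda>t. S t x) x (at_right 0))"

definition is_generator :: "'v::real_vector set \<Rightarrow> ('v \<Rightarrow> real) \<Rightarrow> (real \<Rightarrow> 'v \<Rightarrow> 'v) \<Rightarrow> ('v \<Rightarrow> 'v) \<Rightarrow> 'v set \<Rightarrow> bool" where
  "is_generator C n S A D \<longleftrightarrow> C0_semigroup C n S \<and>
     (\<forall>x\<in>C. x \<in> D \<longleftrightarrow> (\<exists>y\<in>C. tends_in n (\<lambda>h. inverse h *\<^sub>R (S h x - x)) y (at_right 0)))
   \<and> (\<forall>x\<in>D. A x \<in> C \<and> tends_in n (\<lambda>h. inverse h *\<^sub>R (S h x - x)) (A x) (at_right 0))"

definition Iint :: "real \<Rightarrow> ereal \<Rightarrow> real set" where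
  "Iint aL aU = {a. aL < a \<and> ereal a < aU}"

definition standing_assumptions ::
  "real \<Rightarrow> ereal \<Rightarrow> (real \<Rightarrow> 'v::real_vector set) \<Rightarrow> (real \<Rightarrow> 'v \<Rightarrow> real)
   \<Rightarrow> (real \<Rightarrow> 'v set) \<Rightarrow> (real \<Rightarrow> 'v set) \<Rightarrow> ('v \<Rightarrow> 'v) \<Rightarrow> (real \<Rightarrow> real \<Rightarrow> 'v \<Rightarrow> 'v)
   \<Rightarrow> real \<Rightarrow> real \<Rightarrow> (real \<Rightarrow> real) \<Rightarrow> (real \<Rightarrow> real) \<Rightarrow> ('v \<Rightarrow> 'v) \<Rightarrow> bool" where
  "standing_assumptions aL aU B nrm C D A S \<nu> \<omega> M N Z \<longleftrightarrow>
   \<comment> \<open>(A1)\<close>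
     aL > 0 \<and> aU > 0
   \<and> (\<forall>a\<in>Iint aL aU. banach_on (B a) (nrm a))
   \<and> (\<forall>a1\<in>Iint aL aU. \<forall>a2\<in>Iint aL aU. a1 \<le> a2 \<longrightarrow>
        B a1 \<subseteq> B a2 \<and> (\<forall>u\<in>B a1. nrm a2 u \<le> nrm a1 u))
   \<comment> \<open>(A2)\<close>
   \<and> (\<forall>a\<in>Iint aL aU. closed_subspace_in (B a) (nrm a) (C a) \<and> D a \<subseteq> C a \<and> subspace_on (D a)
        \<and> dense_in (nrm a) (D a) (C a))
   \<and> (\<forall>x\<in>(\<Union>a\<in>Iint aL aU. B a). A x \<in> (\<Union>a\<in>Iint aL aU. B a))
   \<and> linear_on (\<Union>a\<in>Iint aL aU. B a) A
   \<and> (\<forall>a\<in>Iint aL aU. is_generator (C a) (nrm a) (S a) A (D a))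
   \<and> (\<forall>a1\<in>Iint aL aU. \<forall>a\<in>Iint aL aU. a1 < a \<longrightarrow>
        B a1 \<subseteq> D a \<and> (\<forall>t\<ge>0. \<forall>x\<in>B a1. S a t x \<in> B a1 \<and> S a t x = S a1 t x))
   \<and> \<nu> \<ge> 1
   \<and> (\<forall>a\<in>Iint aL aU. \<forall>t\<ge>0. \<forall>x\<in>C a. nrm a (S a t x) \<le> \<nu> * exp (\<omega> * t) * nrm a x)
   \<comment> \<open>(A3)\<close>
   \<and> (\<forall>a\<in>Iint aL aU. M a > 0 \<and> N a > 0)
   \<and> mono_on (Iint aL aU) M \<and> mono_on (Iint aL aU) N
   \<and> continuous_on (Iint aL aU) M \<and> continuous_on (Iint aL aU) N
   \<and> (\<forall>x\<in>(\<Union>a\<in>Iint aL aU. B a). Z x \<in> (\<Union>a\<in>Iint aL aU. B a))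
   \<and> linear_on (\<Union>a\<in>Iint aL aU. B a) Z
   \<and> (\<forall>as\<in>Iint aL aU. \<forall>a1 a2. aL < a1 \<and> a1 < a2 \<and> a2 \<le> as \<longrightarrow>
        (\<forall>u\<in>B a1. Z u \<in> B a2 \<and> nrm a2 (Z u) \<le> (M as / (a2 - a1) + N as) * nrm a1 u))"

definition Tfun :: "real \<Rightarrow> (real \<Rightarrow> real) \<Rightarrow> real \<Rightarrow> real \<Rightarrow> real" where
  "Tfun \<nu> M a b = (b - a) / (exp 1 * \<nu> * M b)"

end

theory Submission
  imports Defs
begin

text \<open>
  Put \<open>X = (\<Inter>a\<in>{as<..astar}. B a)\<close>, a Frechet space with the norms \<open>nrm a\<close>. The operators \<open>A\<close>, \<open>Z\<close> and
  the semigroup map \<open>X\<close> continuously into itself, at the price of an arbitrarily small increase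
  of the index (for \<open>A\<close> this is the Banach-Steinhaus theorem). The solution is the series of the Picard
  iterates \<open>U 0 t = S t us\<close>, \<open>U (k + 1)' = A (U (k + 1)) + Z (U k)\<close>, all of which live in \<open>X\<close> for all
  times. Vector-valued integrals are avoided: the Duhamel integral is a limit of explicit Riemann
  sums, and differential equations are replaced by increment estimates of second order in the step,
  which telescope. Splitting the total loss in the scale evenly over the applications of
  \<open>Z\<close> gives \<open>nrm b (U k t) \<le> G * q ^ k\<close> with \<open>q < 1\<close> for some \<open>b < astar\<close>, as long as \<open>t\<close> stays
  below \<open>T\<close>; boundedness of \<open>A, Z\<close> from \<open>B b\<close> to \<open>B astar\<close> then lets the equation pass to the limit.
\<close>

text \<open>\<open>A\<close> and \<open>Z\<close> are controlled only from one space of the scale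
  into a larger one, so no fixed point argument inside a single \<open>B a\<close> is available. The
  index range is open at \<open>as\<close>: below every index there is another one, which pays for
  one more application of an operator. Hence \<open>X\<close> is invariant, \<open>A (A x)\<close>
  makes sense, and this second application yields the quadratic remainders. All iterates exist on
  the whole of \<open>[0, T]\<close>; only summability of the series restricts time.

  The constants in the quadratic remainders are not controlled along the iteration. They need not
  be: a quadratic error disappears when the interval is subdivided, and what remains is a mean value
  inequality that mentions only the derivative. That inequality, not the remainder estimate, is
  carried to the limit.

  The ratio of the series is \<open>exp 1 * \<nu> * M astar * r / (b - a)\<close> for times up to
  \<open>r\<close>. For \<open>r \<ge> 0\<close> it can be made smaller than 1 with
  \<open>as < a < b < astar\<close> exactly when \<open>r < T\<close>; the two strict inequalities
  at the ends leave room for starting in \<open>X\<close> and for applying \<open>A\<close> and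
  \<open>Z\<close> to the limit.\<close>

lemma le_by_inverse_nat:
  fixes x c K :: real
  assumes "\<And>N::nat. N > 0 \<Longrightarrow> x \<le> c + K / real N"
  shows "x \<le> c"
proof -
  have "(\<lambda>N. c + K / real N) \<longlonglongrightarrow> c + 0"
    by (intro tendsto_add tendsto_const lim_const_over_n)
  then have "x \<le> c + 0"
    by (rule LIMSEQ_le_const) (use assms in \<open>auto intro!: exI[of _ 1]\<close>)
  then show ?thesis by simp
qed

lemma le_by_epsilon_mult:
  fixes x c K :: real
  assumes "\<And>e. e > 0 \<Longrightarrow> x \<le> c + K * e" and "K \<ge> 0"
  shows "x \<le> c"
proof (rule field_le_epsilon)
  fix e :: real assume e: "e > 0"
  \<comment> \<open>Dividing by \<open>K + 1\<close> rather than \<open>K\<close> covers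
    \<open>K = 0\<close>.\<close>
  have "x \<le> c + K * (e / (K + 1))" using e \<open>K \<ge> 0\<close> by (intro assms) auto
  moreover have "K * (e / (K + 1)) \<le> e" using e \<open>K \<ge> 0\<close> by (simp add: field_simps)
  ultimately show "x \<le> c + e" by linarith
qed

section \<open>Normed subspaces of an ambient vector space\<close>

text \<open>The norm is a parameter because one vector is measured in many norms at once. The locale
  is used for each \<open>B a\<close> with its own norm, and for the intersection \<open>X\<close>
  with every norm of the scale; completeness is kept separate since \<open>X\<close> is complete
  only for all its norms together.\<close>

locale normed_subspace =
  fixes X :: "'v::real_vector set" and n :: "'v \<Rightarrow> real"
  assumes subspace: "subspace_on X" and norm: "norm_on X n"
begin

lemma zero_mem [simp]: "0 \<in> X"
  and add_mem: "x \<in> X \<Longrightarrow> y \<in> X \<Longrightarrow> x + y \<in> X"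
  and scale_mem: "x \<in> X \<Longrightarrow> c *\<^sub>R x \<in> X"
  using subspace by (auto simp: subspace_on_def)

lemma minus_mem: "x \<in> X \<Longrightarrow> - x \<in> X"
  using scale_mem[of x "-1"] by simp

lemma diff_mem: "x \<in> X \<Longrightarrow> y \<in> X \<Longrightarrow> x - y \<in> X"
  using add_mem[of x "- y"] minus_mem by simp

lemma sum_mem: "(\<And>i. i \<in> I \<Longrightarrow> f i \<in> X) \<Longrightarrow> sum f I \<in> X"
  by (induction I rule: infinite_finite_induct) (auto intro: add_mem)

lemmas mem = zero_mem add_mem scale_mem minus_mem diff_mem sum_mem

lemma nonneg: "x \<in> X \<Longrightarrow> 0 \<le> n x"
  and eq_zero_iff: "x \<in> X \<Longrightarrow> n x = 0 \<longleftrightarrow> x = 0"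
  and triangle: "x \<in> X \<Longrightarrow> y \<in> X \<Longrightarrow> n (x + y) \<le> n x + n y"
  and n_scale: "x \<in> X \<Longrightarrow> n (c *\<^sub>R x) = \<bar>c\<bar> * n x"
  using norm by (auto simp: norm_on_def)

lemma n_zero [simp]: "n 0 = 0"
  using eq_zero_iff[of 0] by simp

lemma n_minus: "x \<in> X \<Longrightarrow> n (- x) = n x"
  using n_scale[of x "-1"] by simp

lemma triangle_diff: "x \<in> X \<Longrightarrow> y \<in> X \<Longrightarrow> n (x - y) \<le> n x + n y"
  using triangle[of x "- y"] by (simp add: minus_mem n_minus)

lemma diff_commute: "x \<in> X \<Longrightarrow> y \<in> X \<Longrightarrow> n (x - y) = n (y - x)"
  using n_minus[of "x - y"] by (simp add: diff_mem)

lemma triangle_via: "x \<in> X \<Longrightarrow> y \<in> X \<Longrightarrow> z \<in> X \<Longrightarrow> n (x - z) \<le> n (x - y) + n (y - z)"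
  using triangle[of "x - y" "y - z"] by (simp add: diff_mem)

lemma n_sum: "(\<And>i. i \<in> I \<Longrightarrow> f i \<in> X) \<Longrightarrow> n (sum f I) \<le> (\<Sum>i\<in>I. n (f i))"
proof (induction I rule: infinite_finite_induct)
  case (insert i I)
  then have "n (f i + sum f I) \<le> n (f i) + n (sum f I)"
    by (intro triangle sum_mem) auto
  with insert show ?case by force
qed auto

text \<open>The right-hand side may vary with \<open>k\<close>, so estimates whose bounds themselves
  converge pass to the limit in one application.\<close>

lemma limit_le:
  assumes "tends_in n f L sequentially" "\<And>k. f k \<in> X" "L \<in> X" "y \<in> X"
    and "g \<longlonglongrightarrow> c" "\<And>k. n (y - f k) \<le> g k"
  shows "n (y - L) \<le> c"
proof (rule field_le_epsilon)
  fix e :: real assume "e > 0"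
  then have "\<forall>\<^sub>F k in sequentially. n (f k - L) < e / 2" "\<forall>\<^sub>F k in sequentially. g k < c + e / 2"
    using assms(1) order_tendstoD(2)[OF assms(5), of "c + e / 2"] half_gt_zero
    unfolding tends_in_def by (blast, simp)
  then have "\<forall>\<^sub>F k in sequentially. n (f k - L) < e / 2 \<and> g k < c + e / 2"
    by (rule eventually_conj)
  then obtain k where "n (f k - L) < e / 2" "g k < c + e / 2"
    by (auto simp: eventually_sequentially)
  then show "n (y - L) \<le> c + e"
    using triangle_via[of y "f k" L] assms by (smt (verit) field_sum_of_halves)
qed

lemma limit_unique:
  assumes "tends_in n f L sequentially" "tends_in n f L' sequentially" "\<And>k. f k \<in> X" "L \<in> X" "L' \<in> X"
  shows "L = L'"
proof -
  have "(\<lambda>k. n (L - f k)) \<longlonglongrightarrow> 0"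
    unfolding lim_sequentially using assms diff_commute
    by (auto simp: tends_in_def eventually_sequentially dist_real_def nonneg mem)
  then have "n (L - L') \<le> 0"
    by (rule limit_le[OF assms(2,3,5,4)]) simp
  then show ?thesis
    using nonneg[of "L - L'"] eq_zero_iff[of "L - L'"] assms by (simp add: mem)
qed

text \<open>Cutting \<open>[s, t]\<close> into \<open>N\<close> pieces of length \<open>h\<close>
  turns the remainders into \<open>N * K * h\<^sup>2\<close>, which tends to 0. So \<open>K\<close>
  does not occur in the conclusion, and the inequality can later be applied to partial sums whose
  constants \<open>K\<close> are unrelated.\<close>

lemma mean_value_bound:
  assumes w: "\<And>t. t \<in> {0..R} \<Longrightarrow> w t \<in> X" and g: "\<And>t. t \<in> {0..R} \<Longrightarrow> g t \<in> X" and y: "y \<in> X"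
    and step: "\<And>t d. 0 \<le> t \<Longrightarrow> 0 \<le> d \<Longrightarrow> t + d \<le> R \<Longrightarrow> n (w (t + d) - w t - d *\<^sub>R g t) \<le> K * d\<^sup>2"
    and st: "0 \<le> s" "s \<le> t" "t \<le> R"
    and gy: "\<And>r. s \<le> r \<Longrightarrow> r \<le> t \<Longrightarrow> n (g r - y) \<le> e"
  shows "n (w t - w s - (t - s) *\<^sub>R y) \<le> (t - s) * e"
proof (rule le_by_inverse_nat)
  fix N :: nat assume N: "N > 0"
  define h where "h = (t - s) / real N"
  have h: "0 \<le> h" "real N * h = t - s" using N st by (auto simp: h_def)
  have "n (w (s + real k * h) - w s - (real k * h) *\<^sub>R y) \<le> real k * (K * h\<^sup>2 + h * e)" if "k \<le> N" for k
    using that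
  proof (induction k)
    case (Suc k)
    let ?r = "s + real k * h"
    have "real (Suc k) * h \<le> real N * h" using Suc.prems h by (intro mult_right_mono) auto
    then have le: "?r + h \<le> t" using h by (simp add: algebra_simps)
    have r: "s \<le> ?r" using h by simp
    have mems: "w (?r + h) \<in> X" "w ?r \<in> X" "g ?r \<in> X" "w s \<in> X"
      using le r h st by (auto intro!: w g)
    \<comment> \<open>The new increment is the local remainder at \<open>?r\<close>, plus
      \<open>h\<close> times the deviation of \<open>g ?r\<close> from \<open>y\<close>, plus the
      increment already estimated.\<close>
    have "w (s + real (Suc k) * h) - w s - (real (Suc k) * h) *\<^sub>R y
        = (w (?r + h) - w ?r - h *\<^sub>R g ?r) + (h *\<^sub>R (g ?r - y) + (w ?r - w s - (real k * h) *\<^sub>R y))"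
      by (simp add: algebra_simps)
    also have "n \<dots> \<le> n (w (?r + h) - w ?r - h *\<^sub>R g ?r)
        + n (h *\<^sub>R (g ?r - y) + (w ?r - w s - (real k * h) *\<^sub>R y))"
      by (intro triangle mem mems y)
    also have "n (h *\<^sub>R (g ?r - y) + (w ?r - w s - (real k * h) *\<^sub>R y))
        \<le> n (h *\<^sub>R (g ?r - y)) + n (w ?r - w s - (real k * h) *\<^sub>R y)"
      by (intro triangle mem mems y)
    also have "n (w (?r + h) - w ?r - h *\<^sub>R g ?r) \<le> K * h\<^sup>2"
      using le r h st by (intro step) auto
    also have "n (h *\<^sub>R (g ?r - y)) = h * n (g ?r - y)"
      using h by (simp add: n_scale mem mems y)
    also have "\<dots> \<le> h * e" using le r h by (intro mult_left_mono gy) auto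
    finally show ?case using Suc by (simp add: algebra_simps)
  qed simp
  from this[of N] have "n (w t - w s - (t - s) *\<^sub>R y) \<le> real N * (K * h\<^sup>2 + h * e)" by (simp add: h)
  also have "\<dots> = (real N * h) * e + K * (real N * h) * h"
    by (simp add: algebra_simps power2_eq_square)
  also have "\<dots> = (t - s) * e + K * (t - s)\<^sup>2 / real N"
    unfolding h by (simp add: h_def power2_eq_square)
  finally show "n (w t - w s - (t - s) *\<^sub>R y) \<le> (t - s) * e + K * (t - s)\<^sup>2 / real N" .
qed

end

section \<open>Linear maps on a subspace and the uniform boundedness principle\<close>

lemma linear_onD:
  assumes "linear_on X f"
  shows "x \<in> X \<Longrightarrow> y \<in> X \<Longrightarrow> f (x + y) = f x + f y" "x \<in> X \<Longrightarrow> f (c *\<^sub>R x) = c *\<^sub>R f x"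
  using assms by (auto simp: linear_on_def)

lemma linear_on_diff:
  assumes "linear_on X f" "subspace_on X" "x \<in> X" "y \<in> X"
  shows "f (x - y) = f x - f y"
proof -
  have "(-1) *\<^sub>R y \<in> X" using assms by (simp only: subspace_on_def)
  then have "f (x + (-1) *\<^sub>R y) = f x + (-1) *\<^sub>R f y"
    using assms by (simp only: linear_on_def)
  then show ?thesis by simp
qed

lemma linear_on_zero:
  assumes "linear_on X f" "subspace_on X"
  shows "f 0 = 0"
  using linear_onD(2)[OF assms(1), of 0 0] assms(2) by (simp add: subspace_on_def)

lemma linear_on_sum:
  assumes "linear_on X f" "subspace_on X" "\<And>i. i \<in> I \<Longrightarrow> g i \<in> X"
  shows "f (sum g I) = (\<Sum>i\<in>I. f (g i))"
  using assms(3)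
proof (induction I rule: infinite_finite_induct)
  case (insert i I)
  have "sum g J \<in> X" if "\<And>i. i \<in> J \<Longrightarrow> g i \<in> X" for J
    using that assms(2) by (induction J rule: infinite_finite_induct) (auto simp: subspace_on_def)
  then have "f (g i + sum g I) = f (g i) + f (sum g I)"
    using insert.prems by (intro linear_onD[OF assms(1)]) auto
  with insert show ?case by simp
qed (auto simp: linear_on_zero[OF assms(1,2)])

text \<open>Baire's theorem for the metric of \<open>n\<close> on \<open>X\<close>, applied to the
  sets where some \<open>T j\<close> exceeds \<open>k\<close>. A ball that misses one of these sets
  carries a common bound for all \<open>T j\<close>, and scaling spreads it over
  \<open>X\<close>.\<close>

lemma uniform_boundedness:
  fixes T :: "nat \<Rightarrow> 'v::real_vector \<Rightarrow> 'v"
  assumes "banach_on X n" "normed_subspace Y m"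
    and T: "\<And>k x. x \<in> X \<Longrightarrow> T k x \<in> Y" "\<And>k. linear_on X (T k)"
    and bdd: "\<And>k. \<exists>K. \<forall>x\<in>X. m (T k x) \<le> K * n x"
    and ptw: "\<And>x. x \<in> X \<Longrightarrow> \<exists>K. \<forall>k. m (T k x) \<le> K"
  shows "\<exists>K. \<forall>k. \<forall>x\<in>X. m (T k x) \<le> K * n x"
proof -
  interpret X: normed_subspace X n using assms(1) by (auto simp: banach_on_def normed_subspace_def)
  interpret Y: normed_subspace Y m by fact
  \<comment> \<open>The value 0 outside \<open>X\<close> keeps \<open>d\<close> nonnegative and
    symmetric for all arguments of the type, as \<open>Metric_space\<close> demands.\<close>
  define d where "d = (\<lambda>x y. if x \<in> X \<and> y \<in> X then n (x - y) else 0)"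
  interpret Metric_space X d
  proof
    show "0 \<le> d x y" for x y by (auto simp: d_def X.nonneg X.mem)
    show "d x y = d y x" for x y by (auto simp: d_def X.diff_commute)
    show "d x y = 0 \<longleftrightarrow> x = y" if "x \<in> X" "y \<in> X" for x y
      using that X.eq_zero_iff[of "x - y"] by (auto simp: d_def X.mem)
    show "d x z \<le> d x y + d y z" if "x \<in> X" "y \<in> X" "z \<in> X" for x y z
      using that X.triangle_via by (auto simp: d_def)
  qed
  have complete: mcomplete
    unfolding mcomplete_def
  proof (intro allI impI)
    fix f assume f: "MCauchy f"
    then have fX: "\<And>k. f k \<in> X" by (auto simp: MCauchy_def)
    have "\<exists>K. \<forall>i\<ge>K. \<forall>j\<ge>K. n (f i - f j) < e" if "e > 0" for e
      using f that unfolding MCauchy_def by (auto simp: d_def fX)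
    then obtain L where L: "L \<in> X" "tends_in n f L sequentially"
      using assms(1) fX unfolding banach_on_def complete_wrt_def by metis
    then have "limitin mtopology f L sequentially"
      unfolding limitin_metric using fX by (auto simp: tends_in_def d_def)
    then show "\<exists>x. limitin mtopology f x sequentially" ..
  qed
  define U where "U = (\<lambda>k::nat. {x \<in> X. \<exists>j. m (T j x) > real k})"
  have U_open: "openin mtopology (U k)" for k
    unfolding openin_mtopology
  proof (intro conjI allI impI)
    fix x assume "x \<in> U k"
    then obtain j where j: "x \<in> X" "m (T j x) > real k" by (auto simp: U_def)
    obtain K where K: "\<forall>x\<in>X. m (T j x) \<le> K * n x" using bdd by blast
    \<comment> \<open>Within this radius \<open>m (T j y)\<close> loses less than the excess of
      \<open>m (T j x)\<close> over \<open>k\<close>; \<open>\<bar>K\<bar> + 1\<close> is positive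
      whatever the sign of \<open>K\<close>.\<close>
    define r where "r = (m (T j x) - real k) / (\<bar>K\<bar> + 1)"
    have "y \<in> U k" if "y \<in> mball x r" for y
    proof -
      have y: "y \<in> X" "n (x - y) < r" using that j unfolding in_mball by (auto simp: d_def)
      have "m (T j x) = m (T j (x - y) + T j y)"
        by (simp add: linear_on_diff[OF T(2) X.subspace j(1) y(1)])
      also have "\<dots> \<le> m (T j (x - y)) + m (T j y)" using y j by (intro Y.triangle T X.mem)
      also have "m (T j (x - y)) \<le> K * n (x - y)" using K y j by (auto intro: X.mem)
      also have "\<dots> \<le> (\<bar>K\<bar> + 1) * n (x - y)" using y j by (intro mult_right_mono X.nonneg X.mem) auto
      also have "(\<bar>K\<bar> + 1) * n (x - y) < (\<bar>K\<bar> + 1) * r" using y by (intro mult_strict_left_mono) auto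
      also have "(\<bar>K\<bar> + 1) * r = m (T j x) - real k" unfolding r_def by (simp add: field_simps)
      finally show ?thesis using y by (auto simp: U_def)
    qed
    moreover have "r > 0" using j by (auto simp: r_def)
    ultimately show "\<exists>r>0. mball x r \<subseteq> U k" by blast
  qed (auto simp: U_def)
  \<comment> \<open>If all these open sets were dense, they would have a common point, at which the
    values \<open>m (T j x)\<close> are unbounded, against \<open>ptw\<close>.\<close>
  have "\<exists>k. mtopology closure_of (U k) \<noteq> X"
  proof (rule ccontr)
    assume "\<not> ?thesis"
    then have "mtopology closure_of (\<Inter>(range U)) = X"
      by (intro metric_Baire_category complete) (auto simp: U_open)
    then have "\<Inter>(range U) \<noteq> {}" using X.zero_mem by fastforce
    then obtain x where x: "\<And>k. x \<in> U k" by auto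
    then obtain K where "\<forall>j. m (T j x) \<le> K" using ptw[of x] by (auto simp: U_def)
    moreover obtain k where "K < real k" using reals_Archimedean2 by blast
    ultimately show False using x[of k] by (auto simp: U_def not_le) (smt (verit))
  qed
  then obtain k x0 where x0: "x0 \<in> X" "x0 \<notin> mtopology closure_of (U k)"
    using closure_of_subset_topspace[of mtopology] by fastforce
  then obtain r where r: "r > 0" "mball x0 r \<inter> U k = {}"
    unfolding metric_closure_of by fastforce
  have small: "m (T j x) \<le> real k" if "x \<in> X" "n (x0 - x) < r" for x j
  proof (rule ccontr)
    assume "\<not> m (T j x) \<le> real k"
    then have "x \<in> U k" "x \<in> mball x0 r"
      using that x0 unfolding U_def in_mball by (auto simp: d_def not_le)
    with r show False by blast
  qed
  have "m (T j x) \<le> (4 * real k / r) * n x" if x: "x \<in> X" for j x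
  proof (cases "x = 0")
    case True
    then show ?thesis using linear_on_zero[OF T(2) X.subspace] by simp
  next
    case False
    then have nx: "n x > 0" using X.nonneg[OF x] X.eq_zero_iff[OF x] by linarith
    \<comment> \<open>The multiple \<open>c *\<^sub>R x\<close> has norm \<open>r / 2\<close>, so
      \<open>x0 + c *\<^sub>R x\<close> stays in the ball. Subtracting the values at the two points
      bounds \<open>c * m (T j x)\<close> by \<open>2 * real k\<close>, which explains the factor
      \<open>4 * real k / r\<close>.\<close>
    define c where "c = r / (2 * n x)"
    have c: "c > 0" "c * n x < r" using nx r by (auto simp: c_def)
    have "n (x0 - (x0 + c *\<^sub>R x)) < r"
      using c x by (simp add: X.n_minus X.n_scale X.mem)
    then have 1: "m (T j (x0 + c *\<^sub>R x)) \<le> real k" using x x0 by (intro small X.mem)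
    have 2: "m (T j x0) \<le> real k" using x0 r by (intro small) auto
    have "c * m (T j x) = m (T j (x0 + c *\<^sub>R x) - T j x0)"
      using x x0 c by (simp add: linear_onD[OF T(2)] X.mem Y.n_scale T)
    also have "\<dots> \<le> 2 * real k"
      using Y.triangle_diff[of "T j (x0 + c *\<^sub>R x)" "T j x0"] 1 2 x x0 T by (simp add: X.mem)
    finally show ?thesis using nx r by (simp add: c_def field_simps)
  qed
  then show ?thesis by blast
qed

section \<open>A semigroup on a scale of norms\<close>

text \<open>Abstract form of the intersection of the spaces with index in \<open>{lo<..hi}\<close>.
  One map \<open>S\<close> suffices because the semigroups of the scale agree there.
  \<open>complete\<close> is completeness as a Frechet space: Cauchy in every norm gives one limit
  for all norms. In \<open>A_bound\<close> the target index may be arbitrarily close to the source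
  index, with no control of \<open>K\<close>.\<close>

locale semigroup_scale =
  fixes X :: "'v::real_vector set" and p :: "real \<Rightarrow> 'v \<Rightarrow> real" and lo hi :: real
    and S :: "real \<Rightarrow> 'v \<Rightarrow> 'v" and A :: "'v \<Rightarrow> 'v" and \<nu> \<omega> :: real
  assumes normed: "a \<in> {lo<..hi} \<Longrightarrow> normed_subspace X (p a)"
    and lo_hi: "lo < hi"
    and complete: "\<lbrakk>\<And>k. f k \<in> X; \<And>a e. a \<in> {lo<..hi} \<Longrightarrow> e > 0 \<Longrightarrow> \<exists>K. \<forall>i\<ge>K. \<forall>j\<ge>K. p a (f i - f j) < e\<rbrakk>
      \<Longrightarrow> \<exists>L\<in>X. \<forall>a\<in>{lo<..hi}. tends_in (p a) f L sequentially"
    and S_mem: "0 \<le> t \<Longrightarrow> x \<in> X \<Longrightarrow> S t x \<in> X"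
    and S_linear: "0 \<le> t \<Longrightarrow> linear_on X (S t)"
    and S_0: "x \<in> X \<Longrightarrow> S 0 x = x"
    and S_add: "0 \<le> t \<Longrightarrow> 0 \<le> r \<Longrightarrow> x \<in> X \<Longrightarrow> S (t + r) x = S t (S r x)"
    and S_bound: "a \<in> {lo<..hi} \<Longrightarrow> 0 \<le> t \<Longrightarrow> x \<in> X \<Longrightarrow> p a (S t x) \<le> \<nu> * exp (\<omega> * t) * p a x"
    and \<nu>_ge_1: "\<nu> \<ge> 1"
    and A_mem: "x \<in> X \<Longrightarrow> A x \<in> X"
    and A_linear: "linear_on X A"
    and A_bound: "lo < a \<Longrightarrow> a < b \<Longrightarrow> b \<le> hi \<Longrightarrow> \<exists>K. \<forall>x\<in>X. p b (A x) \<le> K * p a x"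
    and A_generator: "a \<in> {lo<..hi} \<Longrightarrow> x \<in> X \<Longrightarrow>
      tends_in (p a) (\<lambda>h. inverse h *\<^sub>R (S h x - x)) (A x) (at_right 0)"
begin

lemma subspace: "subspace_on X"
  using normed[of hi] lo_hi by (simp add: normed_subspace_def)

lemma eq_if_norm_le_0:
  assumes "a \<in> {lo<..hi}" "x \<in> X" "y \<in> X" "p a (x - y) \<le> 0"
  shows "x = y"
proof -
  interpret normed_subspace X "p a" using assms by (intro normed)
  show ?thesis using assms nonneg[of "x - y"] eq_zero_iff[of "x - y"] by (simp add: mem)
qed

lemma S_diff: "0 \<le> t \<Longrightarrow> x \<in> X \<Longrightarrow> y \<in> X \<Longrightarrow> S t (x - y) = S t x - S t y"
  by (rule linear_on_diff[OF S_linear subspace])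

lemma S_scale: "0 \<le> t \<Longrightarrow> x \<in> X \<Longrightarrow> S t (c *\<^sub>R x) = c *\<^sub>R S t x"
  by (rule linear_onD[OF S_linear])

text \<open>A bound for the semigroup that is uniform on \<open>[0, R]\<close>; the absolute value
  is there because \<open>\<omega>\<close> may have either sign.\<close>

definition Sbound :: "real \<Rightarrow> real" where "Sbound R = \<nu> * exp (\<bar>\<omega>\<bar> * R)"

lemma Sbound_pos: "Sbound R > 0"
  using \<nu>_ge_1 by (simp add: Sbound_def)

lemma exp_le_Sbound: "0 \<le> t \<Longrightarrow> t \<le> R \<Longrightarrow> \<nu> * exp (\<omega> * t) \<le> Sbound R"
  unfolding Sbound_def using \<nu>_ge_1
  by (intro mult_left_mono iffD2[OF exp_le_cancel_iff]) (auto intro: mult_mono)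

lemma S_le:
  assumes "a \<in> {lo<..hi}" "0 \<le> t" "t \<le> R" "x \<in> X"
  shows "p a (S t x) \<le> Sbound R * p a x"
proof -
  interpret normed_subspace X "p a" using assms by (intro normed)
  have "p a (S t x) \<le> \<nu> * exp (\<omega> * t) * p a x" using assms by (intro S_bound)
  also have "\<dots> \<le> Sbound R * p a x" using assms by (intro mult_right_mono exp_le_Sbound nonneg)
  finally show ?thesis .
qed

text \<open>The small step is a fraction of \<open>t\<close> so that \<open>N\<close> of them land
  exactly on \<open>t\<close>; \<open>N\<close> is taken so large that the difference quotient at
  \<open>t / N\<close> is within \<open>e\<close> of \<open>A x\<close>.\<close>

lemma generator_step:
  assumes a: "a \<in> {lo<..hi}" and x: "x \<in> X" and e: "e > 0" and t: "t > 0"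
  obtains N :: nat where "N > 0" "p a (S (t / N) x - x - (t / N) *\<^sub>R A x) \<le> t / N * e"
proof -
  interpret normed_subspace X "p a" using a by (rule normed)
  have "\<forall>\<^sub>F h in at_right 0. p a (inverse h *\<^sub>R (S h x - x) - A x) < e"
    using A_generator[OF a x] e by (simp add: tends_in_def)
  then obtain h0 where h0: "h0 > 0" "\<And>h. 0 < h \<Longrightarrow> h < h0 \<Longrightarrow> p a (inverse h *\<^sub>R (S h x - x) - A x) < e"
    by (auto simp: eventually_at_right_field)
  obtain N :: nat where N: "t / h0 < real N" using reals_Archimedean2 by blast
  with t h0 have N0: "N > 0" by (metis divide_pos_pos gr0I of_nat_0 order_less_asym)
  define h where "h = t / real N"
  have h: "0 < h" "h < h0" using N N0 t h0 by (auto simp: h_def field_simps)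
  have "S h x - x - h *\<^sub>R A x = h *\<^sub>R (inverse h *\<^sub>R (S h x - x) - A x)"
    using h by (simp add: algebra_simps)
  then have "p a (S h x - x - h *\<^sub>R A x) = h * p a (inverse h *\<^sub>R (S h x - x) - A x)"
    using h x by (simp add: n_scale mem S_mem A_mem)
  also have "\<dots> \<le> h * e" using h h0(2)[OF h] by (intro mult_left_mono) auto
  finally show ?thesis using N0 that unfolding h_def by blast
qed

text \<open>Replaces the integral of \<open>S r (A x)\<close> over \<open>[0, t]\<close>: the
  difference telescopes into the terms \<open>S (k * h) (S h x - x)\<close>, and the generator makes
  \<open>S h x - x\<close> equal to \<open>h *\<^sub>R A x\<close> up to
  \<open>h * e\<close>.\<close>

lemma S_lipschitz:
  assumes a: "a \<in> {lo<..hi}" and x: "x \<in> X" and t: "0 \<le> t" "t \<le> R"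
  shows "p a (S t x - x) \<le> Sbound R * t * p a (A x)"
proof (cases "t = 0")
  case True
  interpret normed_subspace X "p a" using a by (rule normed)
  show ?thesis using x True by (simp add: S_0)
next
  case False
  interpret normed_subspace X "p a" using a by (rule normed)
  have t0: "t > 0" using t False by simp
  show ?thesis
  proof (rule le_by_epsilon_mult)
    fix e :: real assume "e > 0"
    with a x t0 obtain N :: nat where N: "N > 0" "p a (S (t / N) x - x - (t / N) *\<^sub>R A x) \<le> t / N * e"
      using generator_step by blast
    define h where "h = t / N"
    have h: "0 < h" "real N * h = t" using N t0 by (auto simp: h_def)
    have "p a (S (real k * h) x - x) \<le> real k * (Sbound R * p a (S h x - x))" if "k \<le> N" for k
      using that
    proof (induction k)
      case (Suc k)
      have "real k * h \<le> real N * h" using Suc.prems h by (intro mult_right_mono) auto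
      then have k: "0 \<le> real k * h" "real k * h \<le> R" using h t by auto
      have "S (real (Suc k) * h) x - x = S (real k * h) (S h x - x) + (S (real k * h) x - x)"
        using S_add[of "real k * h" h x] x h k by (simp add: algebra_simps S_diff S_mem)
      also have "p a \<dots> \<le> p a (S (real k * h) (S h x - x)) + p a (S (real k * h) x - x)"
        using x h k by (intro triangle mem S_mem) auto
      also have "p a (S (real k * h) (S h x - x)) \<le> Sbound R * p a (S h x - x)"
        using x h k a by (intro S_le mem S_mem) auto
      finally show ?case using Suc by (simp add: algebra_simps)
    qed (use x in \<open>simp add: S_0\<close>)
    from this[of N] have "p a (S t x - x) \<le> real N * (Sbound R * p a (S h x - x))" by (simp add: h)
    also have "p a (S h x - x) \<le> p a (S h x - x - h *\<^sub>R A x) + p a (h *\<^sub>R A x)"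
      using triangle[of "S h x - x - h *\<^sub>R A x" "h *\<^sub>R A x"] h x by (simp add: mem S_mem A_mem)
    also have "p a (h *\<^sub>R A x) = h * p a (A x)" using h x by (simp add: n_scale A_mem)
    also have "p a (S h x - x - h *\<^sub>R A x) \<le> h * e" using N by (simp add: h_def)
    finally have "p a (S t x - x) \<le> real N * (Sbound R * (h * e + h * p a (A x)))"
      using Sbound_pos[of R] by (simp add: mult_left_mono)
    also have "\<dots> = Sbound R * (real N * h) * p a (A x) + Sbound R * (real N * h) * e"
      by (simp add: algebra_simps)
    finally show "p a (S t x - x) \<le> Sbound R * t * p a (A x) + Sbound R * t * e" by (simp add: h)
  qed (use t Sbound_pos[of R] in simp)
qed

text \<open>Since \<open>A x\<close> lies in \<open>X\<close> again, \<open>S_lipschitz\<close>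
  applies to it and bounds \<open>S r (A x) - A x\<close> by a multiple of \<open>t\<close>. Summing
  this over the steps gives the quadratic order; the factor 1/2 of Taylor's formula is given
  away.\<close>

lemma S_taylor:
  assumes a: "a \<in> {lo<..hi}" and x: "x \<in> X" and t: "0 \<le> t" "t \<le> R"
  shows "p a (S t x - x - t *\<^sub>R A x) \<le> Sbound R * t\<^sup>2 * p a (A (A x))"
proof (cases "t = 0")
  case True
  interpret normed_subspace X "p a" using a by (rule normed)
  show ?thesis using x True by (simp add: S_0)
next
  case False
  interpret normed_subspace X "p a" using a by (rule normed)
  have t0: "t > 0" using t False by simp
  show ?thesis
  proof (rule le_by_epsilon_mult)
    fix e :: real assume "e > 0"
    with a x t0 obtain N :: nat where N: "N > 0" "p a (S (t / N) x - x - (t / N) *\<^sub>R A x) \<le> t / N * e"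
      using generator_step by blast
    define h where "h = t / N"
    have h: "0 < h" "real N * h = t" using N t0 by (auto simp: h_def)
    have "p a (S (real k * h) x - x - (real k * h) *\<^sub>R A x)
        \<le> real k * (Sbound R * (h * e) + h * (Sbound R * t * p a (A (A x))))" if "k \<le> N" for k
      using that
    proof (induction k)
      case (Suc k)
      let ?r = "real k * h"
      have "?r \<le> real N * h" using Suc.prems h by (intro mult_right_mono) auto
      then have k: "0 \<le> ?r" "?r \<le> t" using h t by auto
      have mems: "S h x \<in> X" "A x \<in> X" "S ?r x \<in> X" "S ?r (A x) \<in> X" "A (A x) \<in> X"
        using h k x by (auto intro: S_mem A_mem)
      have Sdiff: "S ?r (S h x - x - h *\<^sub>R A x) = S ?r (S h x) - S ?r x - h *\<^sub>R S ?r (A x)"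
        using k x mems by (simp add: S_diff S_scale mem)
      have "S (real (Suc k) * h) x - x - (real (Suc k) * h) *\<^sub>R A x =
          S ?r (S h x - x - h *\<^sub>R A x) + (h *\<^sub>R (S ?r (A x) - A x) + (S ?r x - x - ?r *\<^sub>R A x))"
        using S_add[of ?r h x] x h k Sdiff by (simp add: algebra_simps)
      also have "p a \<dots> \<le> p a (S ?r (S h x - x - h *\<^sub>R A x)) + p a (h *\<^sub>R (S ?r (A x) - A x) + (S ?r x - x - ?r *\<^sub>R A x))"
        using k by (intro triangle mem mems x S_mem)
      also have "p a (h *\<^sub>R (S ?r (A x) - A x) + (S ?r x - x - ?r *\<^sub>R A x))
          \<le> p a (h *\<^sub>R (S ?r (A x) - A x)) + p a (S ?r x - x - ?r *\<^sub>R A x)"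
        by (intro triangle mem mems x)
      also have "p a (h *\<^sub>R (S ?r (A x) - A x)) = h * p a (S ?r (A x) - A x)"
        using h by (simp add: n_scale mem mems)
      also have "\<dots> \<le> h * (Sbound R * t * p a (A (A x)))"
      proof (intro mult_left_mono)
        have "p a (S ?r (A x) - A x) \<le> Sbound R * ?r * p a (A (A x))"
          using k t by (intro S_lipschitz a mems) auto
        also have "\<dots> \<le> Sbound R * t * p a (A (A x))"
          using k Sbound_pos[of R] by (intro mult_right_mono mult_left_mono nonneg mems) auto
        finally show "p a (S ?r (A x) - A x) \<le> Sbound R * t * p a (A (A x))" .
      qed (use h in auto)
      also have "p a (S ?r (S h x - x - h *\<^sub>R A x)) \<le> Sbound R * p a (S h x - x - h *\<^sub>R A x)"
        using k t by (intro S_le a mem mems x) auto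
      also have "\<dots> \<le> Sbound R * (h * e)"
        using N Sbound_pos[of R] by (intro mult_left_mono) (auto simp: h_def)
      finally show ?case using Suc by (simp add: algebra_simps)
    qed (use x in \<open>simp add: S_0\<close>)
    from this[of N]
    have "p a (S t x - x - t *\<^sub>R A x) \<le> real N * (Sbound R * (h * e) + h * (Sbound R * t * p a (A (A x))))"
      by (simp add: h)
    also have "\<dots> = Sbound R * (real N * h) * t * p a (A (A x)) + Sbound R * (real N * h) * e"
      by (simp add: algebra_simps)
    finally show "p a (S t x - x - t *\<^sub>R A x) \<le> Sbound R * t\<^sup>2 * p a (A (A x)) + Sbound R * t * e"
      by (simp add: h power2_eq_square mult.assoc)
  qed (use t Sbound_pos[of R] in simp)
qed

text \<open>A discrete form of variation of constants with zero initial value. With \<open>N\<close>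
  steps of length \<open>d = t / N\<close>, the part \<open>K * d * d\<close> of the step errors
  sums to a multiple of \<open>1 / N\<close> and vanishes, while the part with the fixed
  \<open>h\<close> remains.\<close>

lemma telescoping_bound:
  assumes a: "a \<in> {lo<..hi}" and D: "\<And>t. t \<in> {0..R} \<Longrightarrow> D t \<in> X" and D0: "D 0 = 0"
    and step: "\<And>t d. 0 \<le> t \<Longrightarrow> 0 \<le> d \<Longrightarrow> t + d \<le> R \<Longrightarrow> p a (D (t + d) - S d (D t)) \<le> K * d * (d + h)"
    and t: "0 \<le> t" "t \<le> R"
  shows "p a (D t) \<le> Sbound R * K * t * h"
proof (rule le_by_inverse_nat)
  interpret normed_subspace X "p a" using a by (rule normed)
  fix N :: nat assume N: "N > 0"
  define d where "d = t / N"
  have d: "0 \<le> d" "real N * d = t" using N t by (auto simp: d_def)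
  \<comment> \<open>Carrying \<open>S q\<close> through the induction applies the semigroup to each
    step error only once. Estimating \<open>D\<close> itself from step to step would compound a
    factor at least \<open>\<nu>\<close>, possibly larger than 1, over all \<open>N\<close>
    steps.\<close>
  have "p a (S q (D (real k * d))) \<le> real k * (Sbound R * (K * d * (d + h)))"
    if "k \<le> N" "0 \<le> q" "q + real k * d \<le> R" for k q
    using that
  proof (induction k arbitrary: q)
    case 0
    have "S q 0 = 0" using 0 by (intro linear_on_zero[OF S_linear subspace]) auto
    then show ?case by (simp add: D0)
  next
    case (Suc k)
    let ?r = "real k * d"
    have r: "0 \<le> ?r" "q + (?r + d) \<le> R" using d Suc.prems by (auto simp: algebra_simps)
    have qR: "q \<le> R" using d r by linarith
    have mems: "D (?r + d) \<in> X" "D ?r \<in> X" using r d Suc.prems by (auto intro!: D)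
    have eq: "S q (D (real (Suc k) * d)) = S q (D (?r + d) - S d (D ?r)) + S (q + d) (D ?r)"
      using d Suc.prems mems S_add[of q d "D ?r"] by (simp add: S_diff S_mem algebra_simps)
    have "p a (S q (D (real (Suc k) * d))) \<le> p a (S q (D (?r + d) - S d (D ?r))) + p a (S (q + d) (D ?r))"
      unfolding eq using d Suc.prems by (intro triangle mem S_mem mems) auto
    also have "p a (S q (D (?r + d) - S d (D ?r))) \<le> Sbound R * p a (D (?r + d) - S d (D ?r))"
      using d qR Suc.prems by (intro S_le a mem S_mem mems) auto
    also have "\<dots> \<le> Sbound R * (K * d * (d + h))"
      using d r Suc.prems Sbound_pos[of R] by (intro mult_left_mono step) auto
    also have "p a (S (q + d) (D ?r)) \<le> real k * (Sbound R * (K * d * (d + h)))"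
      using d r Suc.prems by (intro Suc.IH) auto
    finally show ?case by (simp add: algebra_simps)
  qed
  from this[of N 0] have "p a (D t) \<le> real N * (Sbound R * (K * d * (d + h)))"
    using t by (simp add: d S_0 D)
  also have "\<dots> = Sbound R * K * (real N * d) * (d + h)" by simp
  also have "\<dots> = Sbound R * K * t * h + Sbound R * K * t * t / real N"
    unfolding d by (simp add: d_def algebra_simps)
  finally show "p a (D t) \<le> Sbound R * K * t * h + Sbound R * K * t * t / real N" .
qed

end

section \<open>The inhomogeneous equation\<close>

text \<open>The length of the part of the grid cell $[jh, (j+1)h]$ that lies to the left of $t$.\<close>

definition cell_part :: "real \<Rightarrow> nat \<Rightarrow> real \<Rightarrow> real" where
  "cell_part h j t = max 0 (min h (t - real j * h))"

lemma cell_part_nonneg: "0 \<le> cell_part h j t"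
  by (simp add: cell_part_def)

lemma cell_part_0: "h \<ge> 0 \<Longrightarrow> cell_part h j 0 = 0"
  using mult_nonneg_nonneg[of "real j" h] unfolding cell_part_def by linarith

lemma cell_part_mono: "s \<le> t \<Longrightarrow> cell_part h j s \<le> cell_part h j t"
  by (simp add: cell_part_def max_def min_def)

lemma cell_part_nonzero: "cell_part h j t \<noteq> 0 \<Longrightarrow> real j * h < t"
  by (auto simp: cell_part_def max_def min_def split: if_splits)

lemma cell_part_diff_nonzero:
  "cell_part h j s \<noteq> cell_part h j t \<Longrightarrow> s \<le> t \<Longrightarrow> real j * h \<le> t \<and> s \<le> real j * h + h"
  by (auto simp: cell_part_def max_def min_def split: if_splits)

text \<open>The left side is a left-endpoint Riemann sum of the increasing function
  \<open>r ^ k\<close>, hence at most its integral. The discretized Duhamel term therefore obeys the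
  bound of the true integral without an error term.\<close>

lemma sum_cell_part_power:
  assumes "h \<ge> 0" "t \<ge> 0"
  shows "(\<Sum>j<m. cell_part h j t * (real j * h) ^ k) \<le> min t (real m * h) ^ Suc k / real (Suc k)"
proof (induction m)
  case (Suc m)
  define y z where "y = real m * h" and "z = min t (real (Suc m) * h)"
  show ?case
  proof (cases "t \<le> y")
    case True
    then have "cell_part h m t = 0" "min t (real (Suc m) * h) = min t (real m * h)"
      using assms by (auto simp: y_def cell_part_def min_def algebra_simps)
    with Suc show ?thesis by simp
  next
    case False
    then have y: "0 \<le> y" "y \<le> z" and eqs: "min t (real m * h) = y" "cell_part h m t = z - y"
      using assms by (auto simp: y_def z_def cell_part_def min_def max_def algebra_simps)
    have "(z - y) * (real (Suc k) * y ^ k) = (z - y) * (\<Sum>i<Suc k. y ^ k)" by simp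
    also have "\<dots> \<le> (z - y) * (\<Sum>i<Suc k. z ^ i * y ^ (k - i))"
    proof (intro mult_left_mono sum_mono)
      fix i assume "i \<in> {..<Suc k}"
      then have "y ^ k = y ^ i * y ^ (k - i)" by (simp flip: power_add)
      also have "\<dots> \<le> z ^ i * y ^ (k - i)" using y by (intro mult_right_mono power_mono) auto
      finally show "y ^ k \<le> z ^ i * y ^ (k - i)" .
    qed (use y in simp)
    also have "\<dots> = z ^ Suc k - y ^ Suc k"
      by (simp only: diff_power_eq_sum)
    finally have "(z - y) * y ^ k \<le> (z ^ Suc k - y ^ Suc k) / real (Suc k)"
      by (simp add: field_simps)
    with Suc eqs show ?thesis
      by (simp add: y_def[symmetric] z_def[symmetric] diff_divide_distrib del: of_nat_Suc power_Suc)
  qed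
qed (use assms in simp)

lemma sum_cell_part:
  assumes "h \<ge> 0" "t \<ge> 0"
  shows "(\<Sum>j<m. cell_part h j t) = min t (real m * h)"
proof (induction m)
  case (Suc m)
  then show ?case using assms by (auto simp: cell_part_def min_def max_def algebra_simps)
qed (use assms in simp)

section \<open>Paths that are Lipschitz in every norm of the scale, and the Duhamel integral\<close>

context semigroup_scale
begin

text \<open>The constant may depend on the index \<open>a\<close>. This keeps the class stable under
  operators that lose a little of the scale, so \<open>A\<close> and \<open>Z\<close> can be applied
  to a path repeatedly.\<close>

definition lipschitz_path :: "real \<Rightarrow> (real \<Rightarrow> 'v) \<Rightarrow> bool" where
  "lipschitz_path R f \<longleftrightarrow> (\<forall>t\<in>{0..R}. f t \<in> X) \<and>
     (\<forall>a\<in>{lo<..hi}. \<exists>L\<ge>0. \<forall>r\<in>{0..R}. \<forall>t\<in>{0..R}. p a (f r - f t) \<le> L * \<bar>r - t\<bar>)"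

lemma lipschitz_path_mem: "lipschitz_path R f \<Longrightarrow> t \<in> {0..R} \<Longrightarrow> f t \<in> X"
  by (simp add: lipschitz_path_def)

lemma lipschitz_path_bounded:
  assumes "lipschitz_path R f" "a \<in> {lo<..hi}"
  obtains F where "F \<ge> 0" "\<And>t. t \<in> {0..R} \<Longrightarrow> p a (f t) \<le> F"
proof (cases "R \<ge> 0")
  case True
  interpret normed_subspace X "p a" using assms by (intro normed)
  from assms obtain L where L: "L \<ge> 0" "\<And>r t. r \<in> {0..R} \<Longrightarrow> t \<in> {0..R} \<Longrightarrow> p a (f r - f t) \<le> L * \<bar>r - t\<bar>"
    unfolding lipschitz_path_def by metis
  have f: "\<And>t. t \<in> {0..R} \<Longrightarrow> f t \<in> X" using assms by (auto simp: lipschitz_path_def)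
  have "p a (f t) \<le> L * R + p a (f 0)" if t: "t \<in> {0..R}" for t
  proof -
    have "p a (f t) \<le> p a (f t - f 0) + p a (f 0)"
      using triangle[of "f t - f 0" "f 0"] f t by (simp add: mem)
    also have "p a (f t - f 0) \<le> L * t" using L(2)[of t 0] t by simp
    also have "\<dots> \<le> L * R" using L t by (intro mult_left_mono) auto
    finally show ?thesis by simp
  qed
  moreover have "0 \<le> L * R + p a (f 0)" using L True f[of 0] nonneg by simp
  ultimately show ?thesis using that by blast
next
  case False
  then show ?thesis using that[of 0] by simp
qed

lemma lipschitz_path_linear:
  assumes f: "lipschitz_path R f" and Q: "linear_on X Q" "\<And>x. x \<in> X \<Longrightarrow> Q x \<in> X"
    and bound: "\<And>a b. lo < a \<Longrightarrow> a < b \<Longrightarrow> b \<le> hi \<Longrightarrow> \<exists>K. \<forall>x\<in>X. p b (Q x) \<le> K * p a x"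
  shows "lipschitz_path R (\<lambda>t. Q (f t))"
  unfolding lipschitz_path_def
proof (intro conjI ballI)
  fix b assume b: "b \<in> {lo<..hi}"
  \<comment> \<open>Any index strictly between \<open>lo\<close> and \<open>b\<close> would serve as
    the source of \<open>Q\<close>; one exists because the range is open at
    \<open>lo\<close>.\<close>
  define a where "a = (lo + b) / 2"
  have a: "lo < a" "a < b" using b by (auto simp: a_def)
  then interpret normed_subspace X "p a" using b by (intro normed) auto
  obtain K where K: "\<And>x. x \<in> X \<Longrightarrow> p b (Q x) \<le> K * p a x" using bound[of a b] a b by auto
  obtain L where L: "L \<ge> 0" "\<And>r t. r \<in> {0..R} \<Longrightarrow> t \<in> {0..R} \<Longrightarrow> p a (f r - f t) \<le> L * \<bar>r - t\<bar>"
  proof -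
    have "a \<in> {lo<..hi}" using a b by auto
    with f show ?thesis using that unfolding lipschitz_path_def by blast
  qed
  have "p b (Q (f r) - Q (f t)) \<le> (\<bar>K\<bar> * L) * \<bar>r - t\<bar>" if rt: "r \<in> {0..R}" "t \<in> {0..R}" for r t
  proof -
    have mems: "f r \<in> X" "f t \<in> X" using rt f by (auto intro: lipschitz_path_mem)
    have "p b (Q (f r) - Q (f t)) = p b (Q (f r - f t))"
      using mems by (simp add: linear_on_diff[OF Q(1) subspace])
    also have "\<dots> \<le> K * p a (f r - f t)" using mems by (intro K mem)
    also have "\<dots> \<le> \<bar>K\<bar> * p a (f r - f t)" using mems by (intro mult_right_mono nonneg mem) auto
    also have "\<dots> \<le> \<bar>K\<bar> * (L * \<bar>r - t\<bar>)" using rt by (intro mult_left_mono L) auto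
    finally show ?thesis by simp
  qed
  then show "\<exists>L\<ge>0. \<forall>r\<in>{0..R}. \<forall>t\<in>{0..R}. p b (Q (f r) - Q (f t)) \<le> L * \<bar>r - t\<bar>"
    using L by (intro exI[of _ "\<bar>K\<bar> * L"]) auto
next
  show "Q (f t) \<in> X" if "t \<in> {0..R}" for t
    using that f by (intro Q(2) lipschitz_path_mem)
qed

lemma lipschitz_path_add:
  assumes f: "lipschitz_path R f" and g: "lipschitz_path R g"
  shows "lipschitz_path R (\<lambda>t. f t + g t)"
  unfolding lipschitz_path_def
proof (intro conjI ballI)
  fix a assume a: "a \<in> {lo<..hi}"
  interpret normed_subspace X "p a" using a by (rule normed)
  obtain L where L: "L \<ge> 0" "\<And>r t. r \<in> {0..R} \<Longrightarrow> t \<in> {0..R} \<Longrightarrow> p a (f r - f t) \<le> L * \<bar>r - t\<bar>"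
    using f a unfolding lipschitz_path_def by metis
  obtain L' where L': "L' \<ge> 0" "\<And>r t. r \<in> {0..R} \<Longrightarrow> t \<in> {0..R} \<Longrightarrow> p a (g r - g t) \<le> L' * \<bar>r - t\<bar>"
    using g a unfolding lipschitz_path_def by metis
  have "p a (f r + g r - (f t + g t)) \<le> (L + L') * \<bar>r - t\<bar>" if rt: "r \<in> {0..R}" "t \<in> {0..R}" for r t
  proof -
    have eq: "f r + g r - (f t + g t) = (f r - f t) + (g r - g t)" by simp
    show ?thesis
      unfolding eq distrib_right
      by (intro order_trans[OF triangle add_mono[OF L(2) L'(2)]] rt mem lipschitz_path_mem[OF f] lipschitz_path_mem[OF g])
  qed
  then show "\<exists>L\<ge>0. \<forall>r\<in>{0..R}. \<forall>t\<in>{0..R}. p a (f r + g r - (f t + g t)) \<le> L * \<bar>r - t\<bar>"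
    using L(1) L'(1) by (intro exI[of _ "L + L'"]) auto
next
  interpret normed_subspace X "p hi" using lo_hi by (intro normed) auto
  show "f t + g t \<in> X" if "t \<in> {0..R}" for t
    using that by (intro mem lipschitz_path_mem[OF f] lipschitz_path_mem[OF g])
qed

lemma lipschitz_path_sum:
  fixes U :: "nat \<Rightarrow> real \<Rightarrow> 'v"
  assumes "\<And>k. lipschitz_path R (U k)"
  shows "lipschitz_path R (\<lambda>t. \<Sum>k<N. U k t)"
proof (induction N)
  case 0
  have "0 \<in> X" "p a 0 = 0" if "a \<in> {lo<..hi}" for a
  proof -
    interpret normed_subspace X "p a" using that by (rule normed)
    show "0 \<in> X" "p a 0 = 0" by simp_all
  qed
  then show ?case using lo_hi unfolding lipschitz_path_def by force
next
  case (Suc N)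
  then show ?case using assms lipschitz_path_add by simp
qed

lemma lipschitz_path_A: "lipschitz_path R f \<Longrightarrow> lipschitz_path R (\<lambda>t. A (f t))"
  by (rule lipschitz_path_linear[OF _ A_linear]) (auto intro: A_mem A_bound)

text \<open>\<open>A (A (v t))\<close> is again a Lipschitz path, hence bounded on
  \<open>[0, R]\<close>, so the Taylor remainder has one constant for all base points
  \<open>v t\<close>.\<close>

lemma S_taylor_path:
  assumes v: "lipschitz_path R v" and a: "a \<in> {lo<..hi}"
  obtains K where "\<And>t d. t \<in> {0..R} \<Longrightarrow> 0 \<le> d \<Longrightarrow> d \<le> R \<Longrightarrow> p a (S d (v t) - v t - d *\<^sub>R A (v t)) \<le> K * d\<^sup>2"
proof -
  obtain F where F: "F \<ge> 0" "\<And>t. t \<in> {0..R} \<Longrightarrow> p a (A (A (v t))) \<le> F"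
    using lipschitz_path_bounded[OF lipschitz_path_A[OF lipschitz_path_A[OF v]] a] by blast
  have "p a (S d (v t) - v t - d *\<^sub>R A (v t)) \<le> (Sbound R * F) * d\<^sup>2" if "t \<in> {0..R}" "0 \<le> d" "d \<le> R" for t d
  proof -
    have "p a (S d (v t) - v t - d *\<^sub>R A (v t)) \<le> Sbound R * d\<^sup>2 * p a (A (A (v t)))"
      using that v by (intro S_taylor a) (auto intro: lipschitz_path_mem)
    also have "\<dots> \<le> Sbound R * d\<^sup>2 * F"
      using that Sbound_pos[of R] by (intro mult_left_mono F) auto
    finally show ?thesis by (simp add: mult_ac)
  qed
  then show ?thesis using that by blast
qed

text \<open>Left-endpoint Riemann sum for the integral of \<open>S (t - r) (f r)\<close> over
  \<open>[0, t]\<close>. The grid divides \<open>[0, R]\<close> and does not move with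
  \<open>t\<close>; the end of integration enters through the weights \<open>cell_part\<close>. The
  \<open>max 0\<close> only keeps the time of the semigroup nonnegative at nodes beyond
  \<open>t\<close>, where the weight is 0.\<close>

definition duhamel_sum :: "real \<Rightarrow> (real \<Rightarrow> 'v) \<Rightarrow> nat \<Rightarrow> real \<Rightarrow> 'v" where
  "duhamel_sum R f m t = (let h = R / real (Suc m) in
     \<Sum>j<Suc m. cell_part h j t *\<^sub>R S (max 0 (t - real j * h)) (f (real j * h)))"

lemma grid_mem:
  assumes "R \<ge> 0" "j < Suc m"
  shows "real j * (R / real (Suc m)) \<in> {0..R}"
proof -
  have "real j * R \<le> real (Suc m) * R" using assms by (intro mult_right_mono) auto
  then show ?thesis using assms by (simp add: field_simps)
qed

lemma duhamel_sum_mem: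
  assumes "lipschitz_path R f" "R \<ge> 0"
  shows "duhamel_sum R f m t \<in> X"
proof -
  interpret normed_subspace X "p hi" using lo_hi by (intro normed) auto
  show ?thesis using assms grid_mem[of R _ m] unfolding duhamel_sum_def Let_def
    by (intro mem S_mem lipschitz_path_mem[of R f]) auto
qed

text \<open>As the grid is fixed, applying \<open>S d\<close> to the sum at \<open>t\<close> gives
  the sum at \<open>t + d\<close> with the old weights. The weight increments add up to
  \<open>d\<close> and live on nodes near \<open>[t, t + d]\<close>, where the summand is close to
  \<open>f t\<close>. \<open>K\<close> depends neither on the mesh nor on \<open>t\<close>, which
  makes different meshes comparable.\<close>

lemma duhamel_sum_step:
  assumes f: "lipschitz_path R f" and R: "R \<ge> 0" and a: "a \<in> {lo<..hi}"
  obtains K where "K \<ge> 0" "\<And>m t d. 0 \<le> t \<Longrightarrow> 0 \<le> d \<Longrightarrow> t + d \<le> R \<Longrightarrow>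
    p a (duhamel_sum R f m (t + d) - S d (duhamel_sum R f m t) - d *\<^sub>R f t) \<le> K * d * (d + R / real (Suc m))"
proof -
  interpret normed_subspace X "p a" using a by (rule normed)
  obtain F where F: "F \<ge> 0" "\<And>t. t \<in> {0..R} \<Longrightarrow> p a (A (f t)) \<le> F"
    using lipschitz_path_bounded[OF lipschitz_path_A[OF f] a] by blast
  obtain L where L: "L \<ge> 0" "\<And>r t. r \<in> {0..R} \<Longrightarrow> t \<in> {0..R} \<Longrightarrow> p a (f r - f t) \<le> L * \<bar>r - t\<bar>"
    using f a unfolding lipschitz_path_def by metis
  have "p a (duhamel_sum R f m (t + d) - S d (duhamel_sum R f m t) - d *\<^sub>R f t)
      \<le> (Sbound R * F + L) * d * (d + R / real (Suc m))"
    if td: "0 \<le> t" "0 \<le> d" "t + d \<le> R" for m t d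
  proof -
    define h where "h = R / real (Suc m)"
    have h: "h \<ge> 0" "real (Suc m) * h = R" using R by (auto simp: h_def)
    define g where "g j = real j * h" for j
    define c where "c j = cell_part h j (t + d) - cell_part h j t" for j
    have g: "g j \<in> {0..R}" if "j < Suc m" for j using grid_mem[OF R that] by (simp add: g_def h_def)
    have fg: "f (g j) \<in> X" if "j < Suc m" for j using g[OF that] f by (rule lipschitz_path_mem[rotated])
    have ft: "f t \<in> X" using td f by (auto intro: lipschitz_path_mem)
    have sum_t: "(\<Sum>j<Suc m. cell_part h j s) = s" if "0 \<le> s" "s \<le> R" for s
      using sum_cell_part[of h s "Suc m"] h that by simp
    have sum_c: "(\<Sum>j<Suc m. c j) = d"
      using sum_t[of t] sum_t[of "t + d"] td unfolding c_def sum_subtractf by simp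
    have c0: "c j \<ge> 0" for j using cell_part_mono[of t "t + d" h j] td by (simp add: c_def)
    have S_sum: "S d (duhamel_sum R f m t)
        = (\<Sum>j<Suc m. cell_part h j t *\<^sub>R S (max 0 (t + d - g j)) (f (g j)))"
    proof -
      have "S d (duhamel_sum R f m t)
          = (\<Sum>j<Suc m. S d (cell_part h j t *\<^sub>R S (max 0 (t - g j)) (f (g j))))"
        unfolding duhamel_sum_def Let_def h_def[symmetric] g_def[symmetric]
        by (rule linear_on_sum[OF S_linear subspace]) (use td in \<open>auto intro!: mem S_mem fg\<close>)
      also have "\<dots> = (\<Sum>j<Suc m. cell_part h j t *\<^sub>R S (max 0 (t + d - g j)) (f (g j)))"
      proof (rule sum.cong[OF refl])
        fix j assume j: "j \<in> {..<Suc m}"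
        show "S d (cell_part h j t *\<^sub>R S (max 0 (t - g j)) (f (g j)))
            = cell_part h j t *\<^sub>R S (max 0 (t + d - g j)) (f (g j))"
        proof (cases "cell_part h j t = 0")
          case True
          then show ?thesis using td linear_on_zero[OF S_linear subspace] by simp
        next
          case False
          \<comment> \<open>A nonzero weight puts the node to the left of \<open>t\<close>, so
            \<open>max 0\<close> is inactive and the semigroup law applies.\<close>
          then have "g j < t" unfolding g_def by (rule cell_part_nonzero)
          then have "S (max 0 (t + d - g j)) (f (g j)) = S d (S (max 0 (t - g j)) (f (g j)))"
            using S_add[of d "t - g j" "f (g j)"] td fg[of j] j by (simp add: max_def algebra_simps)
          then show ?thesis using td j by (simp add: S_scale S_mem fg)
        qed
      qed
      finally show ?thesis .
    qed
    have "duhamel_sum R f m (t + d) - S d (duhamel_sum R f m t) - d *\<^sub>R f t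
        = (\<Sum>j<Suc m. c j *\<^sub>R S (max 0 (t + d - g j)) (f (g j))) - (\<Sum>j<Suc m. c j) *\<^sub>R f t"
      unfolding S_sum sum_c unfolding duhamel_sum_def Let_def h_def[symmetric] g_def[symmetric]
      by (simp only: c_def scaleR_diff_left sum_subtractf)
    also have "\<dots> = (\<Sum>j<Suc m. c j *\<^sub>R (S (max 0 (t + d - g j)) (f (g j)) - f t))"
      unfolding scaleR_sum_left by (simp only: scaleR_diff_right sum_subtractf)
    also have "p a \<dots> \<le> (\<Sum>j<Suc m. p a (c j *\<^sub>R (S (max 0 (t + d - g j)) (f (g j)) - f t)))"
      by (intro n_sum mem S_mem fg ft) auto
    also have "\<dots> \<le> (\<Sum>j<Suc m. c j * ((Sbound R * F + L) * (d + h)))"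
    proof (rule sum_mono)
      fix j assume "j \<in> {..<Suc m}"
      then have j: "j < Suc m" by simp
      have eq: "p a (c j *\<^sub>R (S (max 0 (t + d - g j)) (f (g j)) - f t))
          = c j * p a (S (max 0 (t + d - g j)) (f (g j)) - f t)"
        using c0 by (subst n_scale) (auto intro!: mem S_mem fg j ft)
      show "p a (c j *\<^sub>R (S (max 0 (t + d - g j)) (f (g j)) - f t)) \<le> c j * ((Sbound R * F + L) * (d + h))"
      proof (cases "c j = 0")
        case True
        then show ?thesis unfolding eq by simp
      next
        case False
        \<comment> \<open>Both the semigroup time \<open>?q\<close> and the distance of the node
          from \<open>t\<close> are then at most \<open>d + h\<close>: the first is used with the
          Lipschitz bound for \<open>S\<close>, the second with that for \<open>f\<close>.\<close>
        then have "g j \<le> t + d \<and> t \<le> g j + h"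
          unfolding g_def c_def using td by (intro cell_part_diff_nonzero) auto
        then have gj: "g j \<le> t + d" "t \<le> g j + h" by auto
        let ?q = "t + d - g j"
        have q: "0 \<le> ?q" "?q \<le> d + h" "?q \<le> R" using gj td g[OF j] by auto
        have "p a (S ?q (f (g j)) - f t) \<le> p a (S ?q (f (g j)) - f (g j)) + p a (f (g j) - f t)"
          using q by (intro triangle_via S_mem fg j ft)
        also have "p a (S ?q (f (g j)) - f (g j)) \<le> Sbound R * ?q * p a (A (f (g j)))"
          using q by (intro S_lipschitz a fg j)
        also have "\<dots> \<le> Sbound R * (d + h) * F"
          using q Sbound_pos[of R] td h g[OF j] fg[OF j]
          by (intro mult_mono F mult_left_mono nonneg A_mem) auto
        also have "p a (f (g j) - f t) \<le> L * \<bar>g j - t\<bar>" using g[OF j] td by (intro L) auto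
        also have "\<dots> \<le> L * (d + h)" using gj L h td by (intro mult_left_mono) auto
        finally have "p a (S ?q (f (g j)) - f t) \<le> (Sbound R * F + L) * (d + h)"
          by (simp add: algebra_simps)
        then show ?thesis unfolding eq using q c0 by (intro mult_left_mono) auto
      qed
    qed
    also have "\<dots> = d * ((Sbound R * F + L) * (d + h))"
      unfolding sum_distrib_right[symmetric] sum_c ..
    finally show ?thesis by (simp add: h_def mult_ac)
  qed
  moreover have "Sbound R * F + L \<ge> 0" using F L Sbound_pos[of R] by simp
  ultimately show ?thesis using that by blast
qed

text \<open>The weight \<open>exp (\<omega> * r)\<close> reproduces itself, because
  \<open>exp (\<omega> * (t - r)) * exp (\<omega> * r)\<close> does not depend on \<open>r\<close>.
  A Picard step thus costs a single factor \<open>\<nu>\<close> and raises the power of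
  \<open>t\<close> by one, with the divisor of an integrated power.\<close>

lemma duhamel_sum_bound:
  assumes f: "lipschitz_path R f" and R: "R \<ge> 0" and a: "a \<in> {lo<..hi}" and c: "c \<ge> 0"
    and bound: "\<And>r. r \<in> {0..R} \<Longrightarrow> p a (f r) \<le> c * exp (\<omega> * r) * r ^ k"
    and t: "t \<in> {0..R}"
  shows "p a (duhamel_sum R f m t) \<le> \<nu> * c * exp (\<omega> * t) * t ^ Suc k / real (Suc k)"
proof -
  interpret normed_subspace X "p a" using a by (rule normed)
  define h where "h = R / real (Suc m)"
  have h: "h \<ge> 0" "real (Suc m) * h = R" using R by (auto simp: h_def)
  define g where "g j = real j * h" for j
  have g: "g j \<in> {0..R}" if "j < Suc m" for j using grid_mem[OF R that] by (simp add: g_def h_def)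
  have fg: "f (g j) \<in> X" if "j < Suc m" for j using g[OF that] f by (rule lipschitz_path_mem[rotated])
  have "p a (duhamel_sum R f m t) \<le> (\<Sum>j<Suc m. p a (cell_part h j t *\<^sub>R S (max 0 (t - g j)) (f (g j))))"
    unfolding duhamel_sum_def Let_def h_def[symmetric] g_def[symmetric]
    by (intro n_sum mem S_mem fg) auto
  also have "\<dots> \<le> (\<Sum>j<Suc m. (\<nu> * c * exp (\<omega> * t)) * (cell_part h j t * g j ^ k))"
  proof (rule sum_mono)
    fix j assume "j \<in> {..<Suc m}"
    then have j: "j < Suc m" by simp
    have eq: "p a (cell_part h j t *\<^sub>R S (max 0 (t - g j)) (f (g j)))
        = cell_part h j t * p a (S (max 0 (t - g j)) (f (g j)))"
      by (subst n_scale) (auto intro!: S_mem fg j simp: cell_part_nonneg)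
    show "p a (cell_part h j t *\<^sub>R S (max 0 (t - g j)) (f (g j)))
        \<le> (\<nu> * c * exp (\<omega> * t)) * (cell_part h j t * g j ^ k)"
    proof (cases "cell_part h j t = 0")
      case False
      then have gj: "g j < t" unfolding g_def by (rule cell_part_nonzero)
      have "p a (S (t - g j) (f (g j))) \<le> \<nu> * exp (\<omega> * (t - g j)) * p a (f (g j))"
        using gj by (intro S_bound a fg j) auto
      also have "\<dots> \<le> \<nu> * exp (\<omega> * (t - g j)) * (c * exp (\<omega> * g j) * g j ^ k)"
        using \<nu>_ge_1 g[OF j] by (intro mult_left_mono bound) auto
      also have "\<dots> = \<nu> * c * (exp (\<omega> * (t - g j)) * exp (\<omega> * g j)) * g j ^ k" by simp
      also have "exp (\<omega> * (t - g j)) * exp (\<omega> * g j) = exp (\<omega> * t)"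
        by (simp add: algebra_simps flip: exp_add)
      finally have "cell_part h j t * p a (S (t - g j) (f (g j)))
          \<le> cell_part h j t * (\<nu> * c * exp (\<omega> * t) * g j ^ k)"
        by (intro mult_left_mono cell_part_nonneg)
      then show ?thesis unfolding eq using gj by (simp add: mult_ac)
    qed (simp add: eq)
  qed
  also have "\<dots> = (\<nu> * c * exp (\<omega> * t)) * (\<Sum>j<Suc m. cell_part h j t * g j ^ k)"
    by (rule sum_distrib_left[symmetric])
  also have "\<dots> \<le> (\<nu> * c * exp (\<omega> * t)) * (t ^ Suc k / real (Suc k))"
  proof (rule mult_left_mono)
    have "min t (real (Suc m) * h) = t" using h t by simp
    then show "(\<Sum>j<Suc m. cell_part h j t * g j ^ k) \<le> t ^ Suc k / real (Suc k)"
      using sum_cell_part_power[where h = h and t = t and m = "Suc m" and k = k] h(1) t unfolding g_def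
      by (simp only: atLeastAtMost_iff)
  qed (use \<nu>_ge_1 c in simp)
  finally show ?thesis by simp
qed

lemma duhamel_sum_0: "R \<ge> 0 \<Longrightarrow> duhamel_sum R f m 0 = 0"
  unfolding duhamel_sum_def Let_def by (intro sum.neutral ballI) (simp add: cell_part_0)

text \<open>The difference of sums for two meshes starts at 0 and evolves by the semigroup up to
  small errors, so \<open>telescoping_bound\<close> gives a Cauchy rate that is uniform in
  \<open>t\<close>. This holds in every norm, and \<open>complete\<close> supplies one limit for all
  of them.\<close>

lemma duhamel_sum_limit:
  assumes f: "lipschitz_path R f" and R: "R \<ge> 0"
  obtains v where "\<And>t. t \<in> {0..R} \<Longrightarrow> v t \<in> X"
    "\<And>a. a \<in> {lo<..hi} \<Longrightarrow> \<exists>K\<ge>0. \<forall>m. \<forall>t\<in>{0..R}. p a (v t - duhamel_sum R f m t) \<le> K / real (Suc m)"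
proof -
  have cauchy: "\<exists>K\<ge>0. \<forall>m m'. \<forall>t\<in>{0..R}.
      p a (duhamel_sum R f m t - duhamel_sum R f m' t) \<le> K * (1 / real (Suc m) + 1 / real (Suc m'))"
    if a: "a \<in> {lo<..hi}" for a
  proof -
    interpret normed_subspace X "p a" using a by (rule normed)
    obtain K where K: "K \<ge> 0" "\<And>m t d. 0 \<le> t \<Longrightarrow> 0 \<le> d \<Longrightarrow> t + d \<le> R \<Longrightarrow>
        p a (duhamel_sum R f m (t + d) - S d (duhamel_sum R f m t) - d *\<^sub>R f t) \<le> K * d * (d + R / real (Suc m))"
      using duhamel_sum_step[OF f R a] by blast
    have "p a (duhamel_sum R f m t - duhamel_sum R f m' t)
        \<le> (Sbound R * (2 * K) * R * R) * (1 / real (Suc m) + 1 / real (Suc m'))"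
      if t: "t \<in> {0..R}" for m m' t
    proof -
      define D where "D r = duhamel_sum R f m r - duhamel_sum R f m' r" for r
      note mems = duhamel_sum_mem[OF f R]
      have "p a (D t) \<le> Sbound R * (2 * K) * t * (R / real (Suc m) + R / real (Suc m'))"
      proof (rule telescoping_bound[OF a])
        fix t d assume td: "0 \<le> t" "0 \<le> d" "t + d \<le> R"
        let ?E = "\<lambda>m. duhamel_sum R f m (t + d) - S d (duhamel_sum R f m t) - d *\<^sub>R f t"
        have ft: "f t \<in> X" using td f by (auto intro: lipschitz_path_mem)
        \<comment> \<open>The forcing term \<open>d *\<^sub>R f t\<close> is the same for both
          meshes and cancels.\<close>
        have eq: "D (t + d) - S d (D t) = ?E m - ?E m'"
          using td by (simp add: D_def S_diff mems)
        have "p a (D (t + d) - S d (D t)) \<le> p a (?E m) + p a (?E m')"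
          unfolding eq using td by (intro triangle_diff mem mems S_mem ft)
        also have "\<dots> \<le> K * d * (d + R / real (Suc m)) + K * d * (d + R / real (Suc m'))"
          by (intro add_mono K(2) td)
        also have "\<dots> \<le> 2 * K * d * (d + (R / real (Suc m) + R / real (Suc m')))"
        proof -
          have *: "K * d * (d + x) + K * d * (d + y) \<le> 2 * K * d * (d + (x + y))"
            if "0 \<le> K * d * (x + y)" for x y
            using that by (simp add: algebra_simps)
          show ?thesis
            by (intro * mult_nonneg_nonneg add_nonneg_nonneg divide_nonneg_nonneg K(1) td R) auto
        qed
        finally show "p a (D (t + d) - S d (D t)) \<le> 2 * K * d * (d + (R / real (Suc m) + R / real (Suc m')))" .
      qed (use t in \<open>auto simp: D_def duhamel_sum_0[OF R] intro!: mem mems\<close>)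
      also have "\<dots> \<le> Sbound R * (2 * K) * R * (R / real (Suc m) + R / real (Suc m'))"
        using t K(1) R Sbound_pos[of R] by (intro mult_right_mono mult_left_mono) auto
      finally show ?thesis by (simp add: D_def algebra_simps)
    qed
    moreover have "Sbound R * (2 * K) * R * R \<ge> 0" using K(1) R Sbound_pos[of R] by simp
    ultimately show ?thesis by blast
  qed
  have "\<exists>L\<in>X. \<forall>a\<in>{lo<..hi}. tends_in (p a) (\<lambda>m. duhamel_sum R f m t) L sequentially"
    if t: "t \<in> {0..R}" for t
  proof (rule complete)
    fix a e :: real assume a: "a \<in> {lo<..hi}" and e: "e > 0"
    obtain K where K: "K \<ge> 0" "\<And>m m'. p a (duhamel_sum R f m t - duhamel_sum R f m' t)
        \<le> K * (1 / real (Suc m) + 1 / real (Suc m'))"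
      using cauchy[OF a] t by blast
    obtain N :: nat where N: "2 * K / e < real N" using reals_Archimedean2 by blast
    have "p a (duhamel_sum R f i t - duhamel_sum R f j t) < e" if "i \<ge> N" "j \<ge> N" for i j
    proof -
      have "K * (1 / real (Suc i) + 1 / real (Suc j)) \<le> K * (1 / real (Suc N) + 1 / real (Suc N))"
        using that K by (intro mult_left_mono add_mono divide_left_mono) auto
      also have "\<dots> < e" using N e by (simp add: field_simps)
      finally show ?thesis using K(2)[of i j] by linarith
    qed
    then show "\<exists>N. \<forall>i\<ge>N. \<forall>j\<ge>N. p a (duhamel_sum R f i t - duhamel_sum R f j t) < e" by blast
  qed (rule duhamel_sum_mem[OF f R])
  then obtain v where v: "\<And>t. t \<in> {0..R} \<Longrightarrow> v t \<in> X"
    "\<And>t a. t \<in> {0..R} \<Longrightarrow> a \<in> {lo<..hi} \<Longrightarrow> tends_in (p a) (\<lambda>m. duhamel_sum R f m t) (v t) sequentially"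
    by metis
  have "\<exists>K\<ge>0. \<forall>m. \<forall>t\<in>{0..R}. p a (v t - duhamel_sum R f m t) \<le> K / real (Suc m)"
    if a: "a \<in> {lo<..hi}" for a
  proof -
    interpret normed_subspace X "p a" using a by (rule normed)
    obtain K where K: "K \<ge> 0" "\<And>m m' t. t \<in> {0..R} \<Longrightarrow> p a (duhamel_sum R f m t - duhamel_sum R f m' t)
        \<le> K * (1 / real (Suc m) + 1 / real (Suc m'))"
      using cauchy[OF a] by blast
    have "p a (v t - duhamel_sum R f m t) \<le> K / real (Suc m)" if t: "t \<in> {0..R}" for m t
    proof -
      \<comment> \<open>With \<open>m\<close> fixed, \<open>m'\<close> tends to infinity in the
        Cauchy estimate; this turns it into a rate of convergence.\<close>
      have "(\<lambda>m'. K * (1 / real (Suc m) + 1 / real (Suc m'))) \<longlonglongrightarrow> K * (1 / real (Suc m) + 0)"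
        by (intro tendsto_intros LIMSEQ_Suc[OF lim_const_over_n])
      then have "p a (duhamel_sum R f m t - v t) \<le> K * (1 / real (Suc m) + 0)"
        by (rule limit_le[OF v(2)[OF t a] _ v(1)[OF t], rotated 2]) (use t K in \<open>auto intro: duhamel_sum_mem[OF f R]\<close>)
      then show ?thesis using diff_commute[OF v(1)[OF t] duhamel_sum_mem[OF f R], of m t] by simp
    qed
    with K show ?thesis by blast
  qed
  with v(1) show ?thesis using that by blast
qed

text \<open>The limit \<open>v\<close> satisfies the one-step form of the Duhamel formula with
  quadratic error. Once \<open>v\<close> is known to be Lipschitz in every norm, the Taylor estimate
  for \<open>S d (v t)\<close> turns this into \<open>v' = A v + f\<close>. The last property is
  kept general in \<open>a\<close>, \<open>c\<close> and \<open>k\<close> because each Picard step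
  uses it at a different index.\<close>

lemma inhomogeneous_solution:
  assumes f: "lipschitz_path R f" and R: "R \<ge> 0"
  obtains v where "lipschitz_path R v" "v 0 = 0"
    "\<And>a. a \<in> {lo<..hi} \<Longrightarrow> \<exists>K. \<forall>t d. 0 \<le> t \<longrightarrow> 0 \<le> d \<longrightarrow> t + d \<le> R \<longrightarrow>
        p a (v (t + d) - v t - d *\<^sub>R (A (v t) + f t)) \<le> K * d\<^sup>2"
    "\<And>a c k t. a \<in> {lo<..hi} \<Longrightarrow> c \<ge> 0 \<Longrightarrow> \<forall>r\<in>{0..R}. p a (f r) \<le> c * exp (\<omega> * r) * r ^ k
        \<Longrightarrow> t \<in> {0..R} \<Longrightarrow> p a (v t) \<le> \<nu> * c * exp (\<omega> * t) * t ^ Suc k / real (Suc k)"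
proof -
  obtain v where vX: "\<And>t. t \<in> {0..R} \<Longrightarrow> v t \<in> X"
    and v: "\<And>a. a \<in> {lo<..hi} \<Longrightarrow> \<exists>K\<ge>0. \<forall>m. \<forall>t\<in>{0..R}. p a (v t - duhamel_sum R f m t) \<le> K / real (Suc m)"
    using duhamel_sum_limit[OF f R] by blast
  note mems = duhamel_sum_mem[OF f R]
  have bound: "p a (v t) \<le> \<nu> * c * exp (\<omega> * t) * t ^ Suc k / real (Suc k)"
    if a: "a \<in> {lo<..hi}" and c: "c \<ge> 0" "\<forall>r\<in>{0..R}. p a (f r) \<le> c * exp (\<omega> * r) * r ^ k"
      and t: "t \<in> {0..R}" for a c k t
  proof -
    interpret normed_subspace X "p a" using a by (rule normed)
    obtain K where K: "K \<ge> 0" "\<And>m t. t \<in> {0..R} \<Longrightarrow> p a (v t - duhamel_sum R f m t) \<le> K / real (Suc m)"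
      using v[OF a] by blast
    show ?thesis
    proof (rule le_by_inverse_nat)
      fix N :: nat assume "N > 0"
      then obtain m where m: "N = Suc m" using gr0_conv_Suc by blast
      have "p a (v t) \<le> p a (v t - duhamel_sum R f m t) + p a (duhamel_sum R f m t)"
        using triangle[of "v t - duhamel_sum R f m t" "duhamel_sum R f m t"] vX[OF t] by (simp add: mem mems)
      also have "p a (duhamel_sum R f m t) \<le> \<nu> * c * exp (\<omega> * t) * t ^ Suc k / real (Suc k)"
        using c t by (intro duhamel_sum_bound[OF f R a]) auto
      finally show "p a (v t) \<le> \<nu> * c * exp (\<omega> * t) * t ^ Suc k / real (Suc k) + K / real N"
        using K(2)[OF t, of m] unfolding m by linarith
    qed
  qed
  \<comment> \<open>Refining the mesh removes the term \<open>R / real (Suc m)\<close> from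
    \<open>duhamel_sum_step\<close> and leaves an error of second order in \<open>d\<close>.\<close>
  have mild: "\<exists>K\<ge>0. \<forall>t d. 0 \<le> t \<longrightarrow> 0 \<le> d \<longrightarrow> t + d \<le> R \<longrightarrow>
      p a (v (t + d) - S d (v t) - d *\<^sub>R f t) \<le> K * d\<^sup>2" if a: "a \<in> {lo<..hi}" for a
  proof -
    interpret normed_subspace X "p a" using a by (rule normed)
    obtain K where K: "K \<ge> 0" "\<And>m t. t \<in> {0..R} \<Longrightarrow> p a (v t - duhamel_sum R f m t) \<le> K / real (Suc m)"
      using v[OF a] by blast
    obtain K' where K': "K' \<ge> 0" "\<And>m t d. 0 \<le> t \<Longrightarrow> 0 \<le> d \<Longrightarrow> t + d \<le> R \<Longrightarrow>
        p a (duhamel_sum R f m (t + d) - S d (duhamel_sum R f m t) - d *\<^sub>R f t) \<le> K' * d * (d + R / real (Suc m))"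
      using duhamel_sum_step[OF f R a] by blast
    have "p a (v (t + d) - S d (v t) - d *\<^sub>R f t) \<le> K' * d\<^sup>2" if td: "0 \<le> t" "0 \<le> d" "t + d \<le> R" for t d
    proof (rule le_by_inverse_nat)
      fix N :: nat assume "N > 0"
      then obtain m where m: "N = Suc m" using gr0_conv_Suc by blast
      let ?w = "duhamel_sum R f m"
      have ts: "t \<in> {0..R}" "t + d \<in> {0..R}" using td by auto
      have ft: "f t \<in> X" using ts f by (auto intro: lipschitz_path_mem)
      have eq: "v (t + d) - S d (v t) - d *\<^sub>R f t = (v (t + d) - ?w (t + d))
          + ((?w (t + d) - S d (?w t) - d *\<^sub>R f t) - S d (v t - ?w t))"
        using td vX[OF ts(1)] mems by (simp add: S_diff)
      have "p a (v (t + d) - S d (v t) - d *\<^sub>R f t)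
          \<le> p a (v (t + d) - ?w (t + d)) + p a ((?w (t + d) - S d (?w t) - d *\<^sub>R f t) - S d (v t - ?w t))"
        unfolding eq using td by (intro triangle mem S_mem mems ft vX ts)
      also have "p a ((?w (t + d) - S d (?w t) - d *\<^sub>R f t) - S d (v t - ?w t))
          \<le> p a (?w (t + d) - S d (?w t) - d *\<^sub>R f t) + p a (S d (v t - ?w t))"
        using td by (intro triangle_diff mem S_mem mems ft vX ts)
      also have "p a (S d (v t - ?w t)) \<le> Sbound R * p a (v t - ?w t)"
        using td by (intro S_le a mem mems vX ts) auto
      also have "\<dots> \<le> Sbound R * (K / real N)"
        unfolding m using Sbound_pos[of R] ts by (intro mult_left_mono K) auto
      also have "p a (v (t + d) - ?w (t + d)) \<le> K / real N" unfolding m by (intro K ts)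
      also have "p a (?w (t + d) - S d (?w t) - d *\<^sub>R f t) \<le> K' * d * (d + R / real N)"
        unfolding m using td by (intro K')
      finally show "p a (v (t + d) - S d (v t) - d *\<^sub>R f t) \<le> K' * d\<^sup>2 + (K + K' * d * R + Sbound R * K) / real N"
        by (simp add: power2_eq_square add_divide_distrib distrib_left mult.assoc)
    qed
    with K' show ?thesis by blast
  qed
  have v0: "v 0 = 0"
  proof -
    have hi: "hi \<in> {lo<..hi}" using lo_hi by simp
    interpret normed_subspace X "p hi" using hi by (rule normed)
    obtain F where F: "F \<ge> 0" "\<And>t. t \<in> {0..R} \<Longrightarrow> p hi (f t) \<le> F"
      using lipschitz_path_bounded[OF f hi] by blast
    obtain K where K: "K \<ge> 0" "\<And>m t. t \<in> {0..R} \<Longrightarrow> p hi (v t - duhamel_sum R f m t) \<le> K / real (Suc m)"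
      using v[OF hi] by blast
    have "p hi (v 0 - 0) \<le> 0"
    proof (rule le_by_inverse_nat)
      fix N :: nat assume "N > 0"
      then obtain m where m: "N = Suc m" using gr0_conv_Suc by blast
      show "p hi (v 0 - 0) \<le> 0 + K / real N"
        using K(2)[of 0 m] R by (simp add: duhamel_sum_0 m del: of_nat_Suc)
    qed
    with R show ?thesis by (intro eq_if_norm_le_0[OF hi vX zero_mem]) simp_all
  qed
  have lip: "lipschitz_path R v"
    unfolding lipschitz_path_def
  proof (intro conjI ballI)
    fix b assume b: "b \<in> {lo<..hi}"
    \<comment> \<open>The Lipschitz estimate in the norm of \<open>b\<close> needs
      \<open>A (v t)\<close> bounded there, hence \<open>v t\<close> bounded in the norm of a
      smaller index.\<close>
    define a where "a = (lo + b) / 2"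
    have a: "lo < a" "a < b" "a \<in> {lo<..hi}" using b by (auto simp: a_def)
    interpret a: normed_subspace X "p a" using a by (intro normed)
    interpret normed_subspace X "p b" using b by (rule normed)
    obtain Fa where Fa: "Fa \<ge> 0" "\<And>t. t \<in> {0..R} \<Longrightarrow> p a (f t) \<le> Fa"
      using lipschitz_path_bounded[OF f a(3)] by blast
    obtain F where F: "F \<ge> 0" "\<And>t. t \<in> {0..R} \<Longrightarrow> p b (f t) \<le> F"
      using lipschitz_path_bounded[OF f b] by blast
    obtain K where K: "\<And>x. x \<in> X \<Longrightarrow> p b (A x) \<le> K * p a x" using A_bound[of a b] a b by auto
    obtain K' where K': "K' \<ge> 0" "\<And>t d. 0 \<le> t \<Longrightarrow> 0 \<le> d \<Longrightarrow> t + d \<le> R \<Longrightarrow>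
      p b (v (t + d) - S d (v t) - d *\<^sub>R f t) \<le> K' * d\<^sup>2" using mild[OF b] by blast
    \<comment> \<open>A plain bound put into the weighted form that \<open>bound\<close> expects,
      with exponent 0; the product of the two exponentials is at least 1 on
      \<open>[0, R]\<close>.\<close>
    have fa: "p a (f r) \<le> Fa * exp (\<bar>\<omega>\<bar> * R) * exp (\<omega> * r) * r ^ 0" if "r \<in> {0..R}" for r
    proof -
      have "\<bar>\<omega>\<bar> * r \<le> \<bar>\<omega>\<bar> * R" using that by (intro mult_left_mono) auto
      moreover have "- (\<bar>\<omega>\<bar> * r) \<le> \<omega> * r" using mult_right_mono[of "- \<bar>\<omega>\<bar>" \<omega> r] that by simp
      ultimately have "Fa * 1 \<le> Fa * exp (\<bar>\<omega>\<bar> * R + \<omega> * r)"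
        using Fa(1) by (intro mult_left_mono) auto
      with Fa(2)[OF that] show ?thesis by (simp add: exp_add)
    qed
    define V where "V = \<nu> * (Fa * exp (\<bar>\<omega>\<bar> * R)) * exp (\<bar>\<omega>\<bar> * R) * R"
    have V: "p a (v t) \<le> V" if t: "t \<in> {0..R}" for t
    proof -
      have "p a (v t) \<le> \<nu> * (Fa * exp (\<bar>\<omega>\<bar> * R)) * exp (\<omega> * t) * t ^ Suc 0 / real (Suc 0)"
        using t fa Fa by (intro bound a) auto
      also have "\<dots> = (\<nu> * exp (\<omega> * t)) * ((Fa * exp (\<bar>\<omega>\<bar> * R)) * t)" by simp
      also have "\<dots> \<le> Sbound R * ((Fa * exp (\<bar>\<omega>\<bar> * R)) * R)"
        using t Fa Sbound_pos[of R] by (intro mult_mono exp_le_Sbound) auto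
      also have "\<dots> = V" by (simp add: V_def Sbound_def)
      finally show ?thesis .
    qed
    define L where "L = K' * R + Sbound R * (\<bar>K\<bar> * V) + F"
    have step: "p b (v (t + d) - v t) \<le> L * d" if td: "0 \<le> t" "0 \<le> d" "t + d \<le> R" for t d
    proof -
      have ts: "t \<in> {0..R}" "t + d \<in> {0..R}" using td by auto
      have ft: "f t \<in> X" using ts f by (auto intro: lipschitz_path_mem)
      have eq: "v (t + d) - v t = (v (t + d) - S d (v t) - d *\<^sub>R f t) + ((S d (v t) - v t) + d *\<^sub>R f t)" by simp
      have "p b (v (t + d) - v t) \<le> p b (v (t + d) - S d (v t) - d *\<^sub>R f t) + p b ((S d (v t) - v t) + d *\<^sub>R f t)"
        unfolding eq using td by (intro triangle mem S_mem ft vX ts)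
      also have "p b ((S d (v t) - v t) + d *\<^sub>R f t) \<le> p b (S d (v t) - v t) + p b (d *\<^sub>R f t)"
        using td by (intro triangle mem S_mem ft vX ts)
      also have "p b (d *\<^sub>R f t) \<le> d * F" using td F(2)[OF ts(1)] ft by (simp add: n_scale mult_left_mono)
      also have "p b (S d (v t) - v t) \<le> Sbound R * d * p b (A (v t))"
        using td by (intro S_lipschitz b vX ts) auto
      also have "\<dots> \<le> Sbound R * d * (\<bar>K\<bar> * V)"
      proof (intro mult_left_mono)
        have "p b (A (v t)) \<le> K * p a (v t)" by (intro K vX ts)
        also have "\<dots> \<le> \<bar>K\<bar> * p a (v t)" by (intro mult_right_mono a.nonneg vX ts) auto
        also have "\<dots> \<le> \<bar>K\<bar> * V" by (intro mult_left_mono V ts) auto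
        finally show "p b (A (v t)) \<le> \<bar>K\<bar> * V" .
      qed (use td Sbound_pos[of R] in auto)
      also have "p b (v (t + d) - S d (v t) - d *\<^sub>R f t) \<le> K' * d\<^sup>2" using td by (intro K')
      also have "K' * d\<^sup>2 \<le> K' * (R * d)"
        unfolding power2_eq_square using td K' by (intro mult_left_mono mult_right_mono) auto
      finally show ?thesis by (simp add: L_def algebra_simps)
    qed
    have "V \<ge> 0" using \<nu>_ge_1 Fa R by (simp add: V_def)
    then have "L \<ge> 0" using K' F R Sbound_pos[of R] by (simp add: L_def)
    moreover have "p b (v r - v t) \<le> L * \<bar>r - t\<bar>" if "r \<in> {0..R}" "t \<in> {0..R}" for r t
    proof (cases "r \<le> t")
      case True
      then show ?thesis using step[of r "t - r"] that diff_commute[OF vX vX, of r t] by simp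
    next
      case False
      then show ?thesis using step[of t "r - t"] that by simp
    qed
    ultimately show "\<exists>L\<ge>0. \<forall>r\<in>{0..R}. \<forall>t\<in>{0..R}. p b (v r - v t) \<le> L * \<bar>r - t\<bar>" by blast
  qed (auto intro: vX)
  have strong: "\<exists>K. \<forall>t d. 0 \<le> t \<longrightarrow> 0 \<le> d \<longrightarrow> t + d \<le> R \<longrightarrow>
      p a (v (t + d) - v t - d *\<^sub>R (A (v t) + f t)) \<le> K * d\<^sup>2" if a: "a \<in> {lo<..hi}" for a
  proof -
    interpret normed_subspace X "p a" using a by (rule normed)
    obtain K where K: "\<And>t d. 0 \<le> t \<Longrightarrow> 0 \<le> d \<Longrightarrow> t + d \<le> R \<Longrightarrow>
      p a (v (t + d) - S d (v t) - d *\<^sub>R f t) \<le> K * d\<^sup>2" using mild[OF a] by blast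
    obtain K' where K': "\<And>t d. t \<in> {0..R} \<Longrightarrow> 0 \<le> d \<Longrightarrow> d \<le> R \<Longrightarrow> p a (S d (v t) - v t - d *\<^sub>R A (v t)) \<le> K' * d\<^sup>2"
      using S_taylor_path[OF lip a] by blast
    have "p a (v (t + d) - v t - d *\<^sub>R (A (v t) + f t)) \<le> (K + K') * d\<^sup>2" if td: "0 \<le> t" "0 \<le> d" "t + d \<le> R" for t d
    proof -
      have ts: "t \<in> {0..R}" "t + d \<in> {0..R}" using td by auto
      have ft: "f t \<in> X" using ts f by (auto intro: lipschitz_path_mem)
      have eq: "v (t + d) - v t - d *\<^sub>R (A (v t) + f t)
          = (v (t + d) - S d (v t) - d *\<^sub>R f t) + (S d (v t) - v t - d *\<^sub>R A (v t))"
        by (simp add: algebra_simps)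
      have "p a (v (t + d) - v t - d *\<^sub>R (A (v t) + f t))
          \<le> p a (v (t + d) - S d (v t) - d *\<^sub>R f t) + p a (S d (v t) - v t - d *\<^sub>R A (v t))"
        unfolding eq using td by (intro triangle mem S_mem ft vX ts A_mem)
      also have "\<dots> \<le> K * d\<^sup>2 + K' * d\<^sup>2" using td by (intro add_mono K K') auto
      finally show ?thesis by (simp add: algebra_simps)
    qed
    then show ?thesis by blast
  qed
  show ?thesis by (rule that[OF lip v0 strong bound])
qed

end

section \<open>Picard iterates of the perturbed equation\<close>

text \<open>\<open>real k ^ k / fact k\<close> is one term of the exponential series at
  \<open>real k\<close>, whose terms are all nonnegative.\<close>

lemma power_le_exp_fact: "real k ^ k \<le> exp (real k) * fact k"
proof -
  have "(\<lambda>i. inverse (fact i) * real k ^ i) sums exp (real k)"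
    using exp_converges[of "real k"] by simp
  then have "(\<Sum>i\<in>{k}. inverse (fact i) * real k ^ i) \<le> exp (real k)"
    by (intro sum_le_suminf[THEN order_trans]) (auto simp: sums_iff)
  then show ?thesis by (simp add: field_simps)
qed

text \<open>\<open>m\<close> and \<open>n\<close> stand for the values of \<open>M\<close> and
  \<open>N\<close> at the top index, so one pair of constants serves all pairs of indices below
  it.\<close>

locale perturbed_scale = semigroup_scale +
  fixes Z :: "'a \<Rightarrow> 'a" and m n :: real
  assumes Z_mem: "x \<in> X \<Longrightarrow> Z x \<in> X"
    and Z_linear: "linear_on X Z"
    and Z_bound: "lo < a \<Longrightarrow> a < b \<Longrightarrow> b \<le> hi \<Longrightarrow> x \<in> X \<Longrightarrow> p b (Z x) \<le> (m / (b - a) + n) * p a x"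
    and m_pos: "m > 0" and n_pos: "n > 0"
    and p_mono: "lo < a \<Longrightarrow> a \<le> b \<Longrightarrow> b \<le> hi \<Longrightarrow> x \<in> X \<Longrightarrow> p b x \<le> p a x"
begin

lemma lipschitz_path_Z: "lipschitz_path R f \<Longrightarrow> lipschitz_path R (\<lambda>t. Z (f t))"
  by (rule lipschitz_path_linear[OF _ Z_linear]) (auto intro: Z_mem Z_bound)

lemma lipschitz_path_S:
  assumes x: "x \<in> X"
  shows "lipschitz_path R (\<lambda>t. S t x)"
  unfolding lipschitz_path_def
proof (intro conjI ballI)
  fix a assume a: "a \<in> {lo<..hi}"
  interpret normed_subspace X "p a" using a by (rule normed)
  define L where "L = Sbound R * Sbound R * p a (A x)"
  have step: "p a (S (t + d) x - S t x) \<le> L * d" if td: "0 \<le> t" "0 \<le> d" "t + d \<le> R" for t d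
  proof -
    have eq: "S (t + d) x - S t x = S t (S d x - x)" using td x by (simp add: S_add S_diff S_mem)
    have "p a (S (t + d) x - S t x) \<le> Sbound R * p a (S d x - x)"
      unfolding eq using td x by (intro S_le a mem S_mem) auto
    also have "\<dots> \<le> Sbound R * (Sbound R * d * p a (A x))"
      using td Sbound_pos[of R] by (intro mult_left_mono S_lipschitz a x) auto
    finally show ?thesis by (simp add: L_def mult_ac)
  qed
  have "p a (S r x - S t x) \<le> L * \<bar>r - t\<bar>" if "r \<in> {0..R}" "t \<in> {0..R}" for r t
  proof (cases "r \<le> t")
    case True
    then show ?thesis using step[of r "t - r"] that diff_commute[of "S r x" "S t x"] x by (simp add: S_mem)
  next
    case False
    then show ?thesis using step[of t "r - t"] that by simp
  qed
  moreover have "L \<ge> 0" using Sbound_pos[of R] nonneg[OF A_mem[OF x]] by (simp add: L_def)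
  ultimately show "\<exists>L\<ge>0. \<forall>r\<in>{0..R}. \<forall>t\<in>{0..R}. p a (S r x - S t x) \<le> L * \<bar>r - t\<bar>" by blast
qed (use x in \<open>auto intro: S_mem\<close>)

text \<open>The equation \<open>v' = g\<close> with a quadratic remainder uniform in
  \<open>t\<close>. This form is additive, so it passes to partial sums, and it is the hypothesis of
  \<open>mean_value_bound\<close>.\<close>

definition approx_solution :: "real \<Rightarrow> (real \<Rightarrow> 'a) \<Rightarrow> (real \<Rightarrow> 'a) \<Rightarrow> bool" where
  "approx_solution R v g \<longleftrightarrow> (\<forall>a\<in>{lo<..hi}. \<exists>K. \<forall>t d. 0 \<le> t \<longrightarrow> 0 \<le> d \<longrightarrow> t + d \<le> R \<longrightarrow>
     p a (v (t + d) - v t - d *\<^sub>R g t) \<le> K * d\<^sup>2)"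

lemma approx_solution_add:
  assumes v: "approx_solution R v g" "approx_solution R v' g'"
    and mems: "\<And>t. t \<in> {0..R} \<Longrightarrow> v t \<in> X \<and> v' t \<in> X \<and> g t \<in> X \<and> g' t \<in> X"
  shows "approx_solution R (\<lambda>t. v t + v' t) (\<lambda>t. g t + g' t)"
  unfolding approx_solution_def
proof
  fix a assume a: "a \<in> {lo<..hi}"
  interpret normed_subspace X "p a" using a by (rule normed)
  obtain K where K: "\<And>t d. 0 \<le> t \<Longrightarrow> 0 \<le> d \<Longrightarrow> t + d \<le> R \<Longrightarrow> p a (v (t + d) - v t - d *\<^sub>R g t) \<le> K * d\<^sup>2"
    using v(1) a unfolding approx_solution_def by blast
  obtain K' where K': "\<And>t d. 0 \<le> t \<Longrightarrow> 0 \<le> d \<Longrightarrow> t + d \<le> R \<Longrightarrow> p a (v' (t + d) - v' t - d *\<^sub>R g' t) \<le> K' * d\<^sup>2"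
    using v(2) a unfolding approx_solution_def by blast
  have "p a (v (t + d) + v' (t + d) - (v t + v' t) - d *\<^sub>R (g t + g' t)) \<le> (K + K') * d\<^sup>2"
    if td: "0 \<le> t" "0 \<le> d" "t + d \<le> R" for t d
  proof -
    have eq: "v (t + d) + v' (t + d) - (v t + v' t) - d *\<^sub>R (g t + g' t)
        = (v (t + d) - v t - d *\<^sub>R g t) + (v' (t + d) - v' t - d *\<^sub>R g' t)"
      by (simp add: algebra_simps)
    have ts: "t \<in> {0..R}" "t + d \<in> {0..R}" using td by auto
    show ?thesis
      unfolding eq distrib_right using mems[OF ts(1)] mems[OF ts(2)]
      by (intro order_trans[OF triangle add_mono[OF K K']] td mem) auto
  qed
  then show "\<exists>K. \<forall>t d. 0 \<le> t \<longrightarrow> 0 \<le> d \<longrightarrow> t + d \<le> R \<longrightarrow>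
      p a (v (t + d) + v' (t + d) - (v t + v' t) - d *\<^sub>R (g t + g' t)) \<le> K * d\<^sup>2" by blast
qed

text \<open>\<open>inhomogeneous_solution\<close> with forcing term \<open>Z (U k t)\<close>
  produces the next iterate and returns a Lipschitz path, so the construction can continue without
  shrinking \<open>[0, R]\<close>.\<close>

lemma picard_iterates:
  assumes x: "x \<in> X" and R: "R \<ge> 0"
  obtains U where "\<And>k. lipschitz_path R (U k)" "U 0 = (\<lambda>t. S t x)" "\<And>k. U (Suc k) 0 = 0"
    "\<And>k. approx_solution R (U (Suc k)) (\<lambda>t. A (U (Suc k) t) + Z (U k t))"
    "\<And>a c k j t. \<lbrakk>a \<in> {lo<..hi}; c \<ge> 0; \<forall>r\<in>{0..R}. p a (Z (U k r)) \<le> c * exp (\<omega> * r) * r ^ j; t \<in> {0..R}\<rbrakk>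
        \<Longrightarrow> p a (U (Suc k) t) \<le> \<nu> * c * exp (\<omega> * t) * t ^ Suc j / real (Suc j)"
proof -
  define Q where "Q u v \<longleftrightarrow> v 0 = 0 \<and> approx_solution R v (\<lambda>t. A (v t) + Z (u t)) \<and>
      (\<forall>a c j t. a \<in> {lo<..hi} \<longrightarrow> c \<ge> 0 \<longrightarrow> (\<forall>r\<in>{0..R}. p a (Z (u r)) \<le> c * exp (\<omega> * r) * r ^ j) \<longrightarrow> t \<in> {0..R}
        \<longrightarrow> p a (v t) \<le> \<nu> * c * exp (\<omega> * t) * t ^ Suc j / real (Suc j))" for u v :: "real \<Rightarrow> 'a"
  have next_exists: "\<exists>v. lipschitz_path R v \<and> Q u v" if u: "lipschitz_path R u" for u
  proof -
    obtain v where "lipschitz_path R v" "v 0 = 0"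
      "\<And>a. a \<in> {lo<..hi} \<Longrightarrow> \<exists>K. \<forall>t d. 0 \<le> t \<longrightarrow> 0 \<le> d \<longrightarrow> t + d \<le> R \<longrightarrow>
        p a (v (t + d) - v t - d *\<^sub>R (A (v t) + Z (u t))) \<le> K * d\<^sup>2"
      "\<And>a c k t. a \<in> {lo<..hi} \<Longrightarrow> c \<ge> 0 \<Longrightarrow> \<forall>r\<in>{0..R}. p a (Z (u r)) \<le> c * exp (\<omega> * r) * r ^ k
        \<Longrightarrow> t \<in> {0..R} \<Longrightarrow> p a (v t) \<le> \<nu> * c * exp (\<omega> * t) * t ^ Suc k / real (Suc k)"
      using inhomogeneous_solution[OF lipschitz_path_Z[OF u] R] by blast
    then show ?thesis unfolding Q_def approx_solution_def by blast
  qed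
  \<comment> \<open>The solution is only known to exist, so each successor is chosen;
    \<open>Q\<close> collects what relates consecutive iterates.\<close>
  define U where "U = rec_nat (\<lambda>t. S t x) (\<lambda>k u. SOME v. lipschitz_path R v \<and> Q u v)"
  have U0: "U 0 = (\<lambda>t. S t x)" by (simp add: U_def)
  have USuc: "U (Suc k) = (SOME v. lipschitz_path R v \<and> Q (U k) v)" for k by (simp add: U_def)
  have lip: "lipschitz_path R (U k)" for k
  proof (induction k)
    case 0
    then show ?case by (simp add: U0 lipschitz_path_S x)
  next
    case (Suc k)
    then show ?case unfolding USuc using someI_ex[OF next_exists] by blast
  qed
  have Q: "Q (U k) (U (Suc k))" for k
    unfolding USuc using someI_ex[OF next_exists[OF lip]] by blast
  show ?thesis
    by (rule that[of U]) (use lip U0 Q in \<open>unfold Q_def, blast+\<close>)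
qed

text \<open>One Picard step raises the index by \<open>d\<close> and contributes
  \<open>m / d + n\<close> from \<open>Z\<close>, \<open>\<nu>\<close> from the semigroup and
  \<open>t / (k + 1)\<close> from integration; the last factors build up \<open>fact k\<close>. The
  loss \<open>d\<close> stays fixed during the induction and is adapted to the final
  \<open>k\<close> only afterwards.\<close>

lemma picard_bound:
  assumes x: "x \<in> X" and R: "R \<ge> 0" and lip: "\<And>k. lipschitz_path R (U k)" and U0: "U 0 = (\<lambda>t. S t x)"
    and U: "\<And>a c k j t. \<lbrakk>a \<in> {lo<..hi}; c \<ge> 0; \<forall>r\<in>{0..R}. p a (Z (U k r)) \<le> c * exp (\<omega> * r) * r ^ j; t \<in> {0..R}\<rbrakk>
        \<Longrightarrow> p a (U (Suc k) t) \<le> \<nu> * c * exp (\<omega> * t) * t ^ Suc j / real (Suc j)"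
    and d: "lo < a" "d > 0" "a + real k * d \<le> hi" and t: "t \<in> {0..R}"
  shows "p (a + real k * d) (U k t) \<le> \<nu> ^ Suc k * (m / d + n) ^ k / fact k * p a x * exp (\<omega> * t) * t ^ k"
  using d(3) t
proof (induction k arbitrary: t)
  case 0
  then show ?case using S_bound[of a t x] d x by (simp add: U0 mult_ac)
next
  case (Suc k)
  let ?b = "a + real k * d"
  have kd: "0 \<le> real k * d" using d by simp
  have b: "lo < ?b" "a \<le> ?b" using d kd by linarith+
  have b': "?b < ?b + d" "a + real (Suc k) * d = ?b + d" "?b + d \<le> hi"
    using d Suc.prems by (auto simp: algebra_simps)
  note b = b(1) b' b(2)
  interpret normed_subspace X "p a" proof -
    have "a \<le> hi" using b by linarith
    with d show "normed_subspace X (p a)" by (intro normed) simp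
  qed
  define c where "c = \<nu> ^ Suc k * (m / d + n) ^ Suc k / fact k * p a x"
  have c: "c \<ge> 0" using \<nu>_ge_1 m_pos n_pos d nonneg[OF x] by (simp add: c_def)
  have "p (?b + d) (Z (U k r)) \<le> c * exp (\<omega> * r) * r ^ k" if r: "r \<in> {0..R}" for r
  proof -
    have "p (?b + d) (Z (U k r)) \<le> (m / d + n) * p ?b (U k r)"
      using Z_bound[OF b(1,2,4), of "U k r"] lipschitz_path_mem[OF lip r] by simp
    also have "\<dots> \<le> (m / d + n) * (\<nu> ^ Suc k * (m / d + n) ^ k / fact k * p a x * exp (\<omega> * r) * r ^ k)"
      using r b m_pos n_pos d by (intro mult_left_mono Suc.IH) auto
    finally show ?thesis by (simp add: c_def mult_ac)
  qed
  then have "p (?b + d) (U (Suc k) t) \<le> \<nu> * c * exp (\<omega> * t) * t ^ Suc k / real (Suc k)"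
  proof (intro U c)
    have "lo < ?b + d" using b by linarith
    then show "?b + d \<in> {lo<..hi}" using b by simp
  qed (use Suc.prems in auto)
  also have "\<dots> = \<nu> ^ Suc (Suc k) * (m / d + n) ^ Suc k / fact (Suc k) * p a x * exp (\<omega> * t) * t ^ Suc k"
    by (simp add: c_def field_simps)
  finally show ?case unfolding b(3) .
qed

text \<open>The loss in the scale is spread evenly over the \<open>k\<close> applications of \<open>Z\<close>, which produces
  the factor \<open>k ^ k / fact k \<le> exp k\<close> and hence the factor \<open>exp 1\<close> in \<open>Tfun\<close>.\<close>

lemma picard_geometric:
  assumes x: "x \<in> X" and R: "R \<ge> 0" and lip: "\<And>k. lipschitz_path R (U k)" and U0: "U 0 = (\<lambda>t. S t x)"
    and U: "\<And>a c k j t. \<lbrakk>a \<in> {lo<..hi}; c \<ge> 0; \<forall>r\<in>{0..R}. p a (Z (U k r)) \<le> c * exp (\<omega> * r) * r ^ j; t \<in> {0..R}\<rbrakk>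
        \<Longrightarrow> p a (U (Suc k) t) \<le> \<nu> * c * exp (\<omega> * t) * t ^ Suc j / real (Suc j)"
    and ab: "lo < a" "a < b" "b \<le> hi" and r: "r \<le> R" and t: "t \<in> {0..r}"
  shows "p b (U k t) \<le> (Sbound R * exp (n * (b - a) / m) * p a x) * (exp 1 * \<nu> * m * r / (b - a)) ^ k"
proof -
  interpret normed_subspace X "p a" using ab by (intro normed) auto
  define D where "D = b - a"
  have D: "D > 0" using ab by (simp add: D_def)
  have tR: "t \<in> {0..R}" using t r by auto
  have px: "p a x \<ge> 0" using nonneg x by blast
  \<comment> \<open>For \<open>k = 0\<close> there is no loss to distribute, and
    \<open>D / real k\<close> would be 0. Monotonicity of the norms suffices, padded by an
    exponential that is at least 1.\<close>
  show ?thesis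
  proof (cases "k = 0")
    case True
    have "p b (U 0 t) \<le> p a (U 0 t)" using ab lipschitz_path_mem[OF lip tR] by (intro p_mono) auto
    also have "\<dots> \<le> Sbound R * p a x" using tR ab x by (auto simp: U0 intro: S_le)
    also have "\<dots> \<le> Sbound R * p a x * exp (n * D / m)"
      using px D m_pos n_pos Sbound_pos[of R] mult_left_mono[of 1 "exp (n * D / m)" "Sbound R * p a x"] by simp
    finally show ?thesis using True by (simp add: D_def mult_ac)
  next
    case False
    then have k: "k > 0" by simp
    define d where "d = D / real k"
    have d: "d > 0" "a + real k * d = b" using k D by (auto simp: d_def D_def)
    define y where "y = real k * m / D"
    have y: "y > 0" using k m_pos D by (simp add: y_def)
    \<comment> \<open>Factoring out \<open>y\<close> confines \<open>n\<close> to
      \<open>(1 + (n * D / m) / k) ^ k\<close>, which is at most \<open>exp (n * D / m)\<close> for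
      every \<open>k\<close>. Thus \<open>n\<close> enters the prefactor but not the ratio, and
      \<open>N\<close> is absent from \<open>Tfun\<close>.\<close>
    have "m / d + n = y * (1 + (n * D / m) / real k)"
      using k D m_pos by (simp add: d_def y_def field_simps)
    then have "(m / d + n) ^ k = y ^ k * (1 + (n * D / m) / real k) ^ k" by (simp add: power_mult_distrib)
    also have "\<dots> \<le> y ^ k * exp (n * D / m)"
    proof (intro mult_left_mono)
      have "0 \<le> n * D / m" using n_pos D m_pos by simp
      then show "(1 + (n * D / m) / real k) ^ k \<le> exp (n * D / m)"
        using k by (intro exp_ge_one_plus_x_over_n_power_n) auto
    qed (use y in simp)
    also have "y ^ k = (m / D) ^ k * real k ^ k" by (simp add: y_def power_mult_distrib power_divide mult_ac)
    also have "\<dots> \<le> (m / D) ^ k * (exp (real k) * fact k)"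
      using m_pos D by (intro mult_left_mono power_le_exp_fact) auto
    finally have *: "(m / d + n) ^ k / fact k \<le> (m / D) ^ k * exp (real k) * exp (n * D / m)"
      by (simp add: field_simps)
    have "p (a + real k * d) (U k t) \<le> \<nu> ^ Suc k * (m / d + n) ^ k / fact k * p a x * exp (\<omega> * t) * t ^ k"
      by (rule picard_bound[where U = U and x = x and R = R and a = a and d = d and t = t and k = k, OF x R _ U0 _ ab(1) d(1) _ tR]) (fact lip U | use d(2) ab(3) in simp)+
    then have "p b (U k t) \<le> \<nu> ^ Suc k * (m / d + n) ^ k / fact k * p a x * exp (\<omega> * t) * t ^ k"
      unfolding d(2) .
    also have "\<dots> = (\<nu> * exp (\<omega> * t)) * (\<nu> ^ k * p a x) * (((m / d + n) ^ k / fact k) * t ^ k)"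
      by simp
    also have "\<dots> \<le> Sbound R * (\<nu> ^ k * p a x) * (((m / D) ^ k * exp (real k) * exp (n * D / m)) * r ^ k)"
      using \<nu>_ge_1 px tR t m_pos n_pos D d Sbound_pos[of R]
      by (intro mult_mono exp_le_Sbound power_mono * order_refl mult_nonneg_nonneg) auto
    also have "exp (real k) = exp 1 ^ k" by (simp add: exp_of_nat_mult[symmetric])
    finally show ?thesis by (simp add: D_def power_mult_distrib power_divide mult_ac)
  qed
qed

text \<open>In the equation of the partial sums the argument of \<open>Z\<close> lags one term
  behind that of \<open>A\<close>, since each iterate is driven by its predecessor. All of
  \<open>x\<close> sits in the zeroth iterate, so the initial value is exact for every nonempty
  partial sum.\<close>

lemma perturbed_series:
  assumes x: "x \<in> X" and R: "R \<ge> 0"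
  obtains U where "\<And>k. lipschitz_path R (U k)" "\<And>N. (\<Sum>k<Suc N. U k 0) = x"
    "\<And>N. approx_solution R (\<lambda>t. \<Sum>k<Suc N. U k t) (\<lambda>t. A (\<Sum>k<Suc N. U k t) + Z (\<Sum>k<N. U k t))"
    "\<And>a b r t k. \<lbrakk>lo < a; a < b; b \<le> hi; r \<le> R; t \<in> {0..r}\<rbrakk> \<Longrightarrow>
      p b (U k t) \<le> (Sbound R * exp (n * (b - a) / m) * p a x) * (exp 1 * \<nu> * m * r / (b - a)) ^ k"
proof -
  obtain U where lip: "\<And>k. lipschitz_path R (U k)" and U0: "U 0 = (\<lambda>t. S t x)" and USuc: "\<And>k. U (Suc k) 0 = 0"
    and approx: "\<And>k. approx_solution R (U (Suc k)) (\<lambda>t. A (U (Suc k) t) + Z (U k t))"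
    and bound: "\<And>a c k j t. \<lbrakk>a \<in> {lo<..hi}; c \<ge> 0; \<forall>r\<in>{0..R}. p a (Z (U k r)) \<le> c * exp (\<omega> * r) * r ^ j; t \<in> {0..R}\<rbrakk>
        \<Longrightarrow> p a (U (Suc k) t) \<le> \<nu> * c * exp (\<omega> * t) * t ^ Suc j / real (Suc j)"
    using picard_iterates[OF x R] by blast
  interpret normed_subspace X "p hi" using lo_hi by (intro normed) auto
  have mems: "U k t \<in> X" if "t \<in> {0..R}" for k t using lip that by (rule lipschitz_path_mem)
  have initial: "(\<Sum>k<Suc N. U k 0) = x" for N
    by (induction N) (simp_all add: U0 S_0 x USuc)
  have sum_approx: "approx_solution R (\<lambda>t. \<Sum>k<Suc N. U k t) (\<lambda>t. A (\<Sum>k<Suc N. U k t) + Z (\<Sum>k<N. U k t))" for N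
  proof (induction N)
    case 0
    have "Z 0 = 0" by (rule linear_on_zero[OF Z_linear subspace])
    moreover have "approx_solution R (U 0) (\<lambda>t. A (U 0 t))"
      unfolding approx_solution_def
    proof
      fix a assume a: "a \<in> {lo<..hi}"
      obtain K where K: "\<And>t d. t \<in> {0..R} \<Longrightarrow> 0 \<le> d \<Longrightarrow> d \<le> R \<Longrightarrow> p a (S d (U 0 t) - U 0 t - d *\<^sub>R A (U 0 t)) \<le> K * d\<^sup>2"
        using S_taylor_path[OF lip a] by blast
      have "U 0 (t + d) = S d (U 0 t)" if "0 \<le> t" "0 \<le> d" for t d
        using S_add[of d t x] that x by (simp add: U0 add.commute)
      then have "p a (U 0 (t + d) - U 0 t - d *\<^sub>R A (U 0 t)) \<le> K * d\<^sup>2" if "0 \<le> t" "0 \<le> d" "t + d \<le> R" for t d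
        using K[of t d] that by simp
      then show "\<exists>K. \<forall>t d. 0 \<le> t \<longrightarrow> 0 \<le> d \<longrightarrow> t + d \<le> R \<longrightarrow>
          p a (U 0 (t + d) - U 0 t - d *\<^sub>R A (U 0 t)) \<le> K * d\<^sup>2" by blast
    qed
    ultimately show ?case by simp
  next
    case (Suc N)
    have sums: "(\<Sum>k<N. U k t) \<in> X" if "t \<in> {0..R}" for N t using that by (intro mem mems)
    have eq: "A (\<Sum>k<Suc N. U k t) + Z (\<Sum>k<N. U k t) + (A (U (Suc N) t) + Z (U N t))
        = A (\<Sum>k<Suc (Suc N). U k t) + Z (\<Sum>k<Suc N. U k t)" if t: "t \<in> {0..R}" for t
      using linear_onD(1)[OF A_linear sums[OF t, of "Suc N"] mems[OF t, of "Suc N"]]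
        linear_onD(1)[OF Z_linear sums[OF t, of N] mems[OF t, of N]] by (simp add: algebra_simps)
    have "approx_solution R (\<lambda>t. (\<Sum>k<Suc N. U k t) + U (Suc N) t)
        (\<lambda>t. A (\<Sum>k<Suc N. U k t) + Z (\<Sum>k<N. U k t) + (A (U (Suc N) t) + Z (U N t)))"
      using sums mems by (intro approx_solution_add Suc approx conjI mem A_mem Z_mem) auto
    then show ?case unfolding approx_solution_def using eq by (simp del: sum.lessThan_Suc) (simp only: sum.lessThan_Suc)
  qed
  show ?thesis
  proof (rule that[of U])
    show "p b (U k t) \<le> (Sbound R * exp (n * (b - a) / m) * p a x) * (exp 1 * \<nu> * m * r / (b - a)) ^ k"
      if "lo < a" "a < b" "b \<le> hi" "r \<le> R" "t \<in> {0..r}" for a b r t k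
      by (rule picard_geometric[of x R U]) (use x R lip U0 bound that in blast)+
  qed (use lip initial sum_approx in blast)+
qed

end

section \<open>Passage to the limit\<close>

text \<open>The usual three-part estimate. Only one approximant is used for a given
  \<open>e\<close>, so the Lipschitz constants may grow with \<open>k\<close>.\<close>

lemma (in normed_subspace) uniform_limit_continuous:
  assumes f: "\<And>t. t \<in> {0..R} \<Longrightarrow> f t \<in> X" and F: "\<And>k t. t \<in> {0..R} \<Longrightarrow> F k t \<in> X"
    and c: "c \<longlonglongrightarrow> 0" "\<And>k t. t \<in> {0..R} \<Longrightarrow> n (f t - F k t) \<le> c k"
    and lip: "\<And>k. \<exists>L\<ge>0. \<forall>r\<in>{0..R}. \<forall>t\<in>{0..R}. n (F k r - F k t) \<le> L * \<bar>r - t\<bar>"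
    and t: "t \<in> {0..R}" and e: "e > 0"
  shows "\<exists>d>0. \<forall>r\<in>{0..R}. \<bar>r - t\<bar> < d \<longrightarrow> n (f r - f t) < e"
proof -
  obtain k where k: "c k < e / 3"
    using order_tendstoD(2)[OF c(1), of "e / 3"] e by (auto simp: eventually_sequentially)
  obtain L where L: "L \<ge> 0" "\<And>r t. r \<in> {0..R} \<Longrightarrow> t \<in> {0..R} \<Longrightarrow> n (F k r - F k t) \<le> L * \<bar>r - t\<bar>"
    using lip by blast
  define d where "d = e / 3 / (L + 1)"
  have "n (f r - f t) < e" if r: "r \<in> {0..R}" "\<bar>r - t\<bar> < d" for r
  proof -
    have "n (f r - f t) \<le> n (f r - F k r) + n (F k r - f t)"
      by (intro triangle_via f F r t)
    also have "n (F k r - f t) \<le> n (F k r - F k t) + n (F k t - f t)"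
      by (intro triangle_via f F r t)
    also have "n (F k t - f t) = n (f t - F k t)" by (intro diff_commute f F t)
    also have "\<dots> < e / 3" using c(2)[OF t, of k] k by linarith
    also have "n (f r - F k r) < e / 3" using c(2)[OF r(1), of k] k by linarith
    also have "n (F k r - F k t) \<le> L * \<bar>r - t\<bar>" by (intro L r t)
    also have "\<dots> \<le> (L + 1) * d" using L r by (intro mult_mono) auto
    also have "\<dots> = e / 3" using L(1) by (simp add: d_def field_simps)
    finally show ?thesis by simp
  qed
  moreover have "d > 0" using L e by (simp add: d_def)
  ultimately show ?thesis by blast
qed

text \<open>The tail bound depends only on \<open>G\<close>, \<open>q\<close> and \<open>N\<close>;
  for terms depending on time this makes the convergence uniform.\<close>

lemma geometric_series_converges:
  fixes U :: "nat \<Rightarrow> 'v::real_vector"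
  assumes Y: "banach_on Y n" and U: "\<And>k. U k \<in> Y" "\<And>k. n (U k) \<le> G * q ^ k" and q: "0 \<le> q" "q < 1"
  shows "\<exists>L\<in>Y. \<forall>N. n (L - (\<Sum>k<N. U k)) \<le> G * q ^ N / (1 - q)"
proof -
  interpret normed_subspace Y n using Y by (auto simp: banach_on_def normed_subspace_def)
  have G: "G \<ge> 0" using nonneg[OF U(1), of 0] U(2)[of 0] by simp
  define V where "V N = (\<Sum>k<N. U k)" for N
  have V: "V N \<in> Y" for N unfolding V_def by (intro mem U)
  have tail: "n (V N - V K) \<le> G * q ^ N / (1 - q)" if "N \<le> K" for N K
  proof -
    \<comment> \<open>The exact finite geometric sum is what the induction reproduces; the term
      \<open>q ^ K\<close> is dropped afterwards.\<close>
    have "n (V N - V K) \<le> G * (q ^ N - q ^ K) / (1 - q)"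
      using that
    proof (induction K rule: dec_induct)
      case (step K)
      have "n (V N - V (Suc K)) \<le> n (V N - V K) + n (V K - V (Suc K))" by (intro triangle_via V)
      also have "V K - V (Suc K) = - U K" by (simp add: V_def)
      also have "n (- U K) = n (U K)" by (rule n_minus[OF U(1)])
      also have "\<dots> \<le> G * q ^ K" by (rule U(2))
      also have "n (V N - V K) \<le> G * (q ^ N - q ^ K) / (1 - q)" by (rule step.IH)
      also have "G * (q ^ N - q ^ K) / (1 - q) + G * q ^ K = G * (q ^ N - q ^ Suc K) / (1 - q)"
        using q by (simp add: field_simps)
      finally show ?case by simp
    qed simp
    also have "\<dots> \<le> G * q ^ N / (1 - q)"
      using G q by (intro divide_right_mono mult_left_mono) auto
    finally show ?thesis .
  qed
  have lim: "(\<lambda>N. G * q ^ N / (1 - q)) \<longlonglongrightarrow> 0"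
    using tendsto_mult_left[OF LIMSEQ_realpow_zero[OF q], of "G / (1 - q)"] by simp
  have "\<exists>K. \<forall>i\<ge>K. \<forall>j\<ge>K. n (V i - V j) < e" if e: "e > 0" for e
  proof -
    obtain K where K: "\<And>N. N \<ge> K \<Longrightarrow> G * q ^ N / (1 - q) < e"
      using order_tendstoD(2)[OF lim e] by (auto simp: eventually_sequentially)
    have "n (V i - V j) < e" if "i \<ge> K" "j \<ge> K" for i j
      using tail[of i j] tail[of j i] K[OF that(1)] K[OF that(2)] diff_commute[OF V V, of i j] by linarith
    then show ?thesis by blast
  qed
  then obtain L where L: "L \<in> Y" "tends_in n V L sequentially"
    using Y V unfolding banach_on_def complete_wrt_def by metis
  have "n (V N - L) \<le> G * q ^ N / (1 - q)" for N
  proof (rule limit_le[where g = "\<lambda>_. G * q ^ N / (1 - q)"])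
    show "tends_in n (\<lambda>k. V (k + N)) L sequentially"
      using L(2) unfolding tends_in_def eventually_sequentially by (meson trans_le_add1)
  qed (use L V tail in auto)
  then have "n (L - V N) \<le> G * q ^ N / (1 - q)" for N using diff_commute[OF L(1) V] by simp
  then show ?thesis using L(1) unfolding V_def by blast
qed

section \<open>From the standing assumptions to the abstract scale, and convergence of the
  series\<close>

locale standing =
  fixes aL :: real and aU :: ereal
    and B C D :: "real \<Rightarrow> 'v::real_vector set" and nrm :: "real \<Rightarrow> 'v \<Rightarrow> real"
    and A Z :: "'v \<Rightarrow> 'v" and S :: "real \<Rightarrow> real \<Rightarrow> 'v \<Rightarrow> 'v"
    and \<nu> \<omega> :: real and M N :: "real \<Rightarrow> real"
  assumes standing: "standing_assumptions aL aU B nrm C D A S \<nu> \<omega> M N Z"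
begin

abbreviation "I \<equiv> Iint aL aU"

lemma standing_facts:
  shows "\<forall>a\<in>I. banach_on (B a) (nrm a)"
    and "\<forall>a1\<in>I. \<forall>a2\<in>I. a1 \<le> a2 \<longrightarrow> B a1 \<subseteq> B a2 \<and> (\<forall>u\<in>B a1. nrm a2 u \<le> nrm a1 u)"
    and "\<forall>a\<in>I. closed_subspace_in (B a) (nrm a) (C a) \<and> D a \<subseteq> C a \<and> subspace_on (D a)
      \<and> dense_in (nrm a) (D a) (C a)"
    and linear_A: "linear_on (\<Union>a\<in>I. B a) A"
    and "\<forall>a\<in>I. is_generator (C a) (nrm a) (S a) A (D a)"
    and "\<forall>a1\<in>I. \<forall>a\<in>I. a1 < a \<longrightarrow>
      B a1 \<subseteq> D a \<and> (\<forall>t\<ge>0. \<forall>x\<in>B a1. S a t x \<in> B a1 \<and> S a t x = S a1 t x)"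
    and nu_ge_1: "\<nu> \<ge> 1"
    and "\<forall>a\<in>I. \<forall>t\<ge>0. \<forall>x\<in>C a. nrm a (S a t x) \<le> \<nu> * exp (\<omega> * t) * nrm a x"
    and "\<forall>a\<in>I. M a > 0 \<and> N a > 0"
    and linear_Z: "linear_on (\<Union>a\<in>I. B a) Z"
    and "\<forall>as\<in>I. \<forall>a1 a2. aL < a1 \<and> a1 < a2 \<and> a2 \<le> as \<longrightarrow>
      (\<forall>u\<in>B a1. Z u \<in> B a2 \<and> nrm a2 (Z u) \<le> (M as / (a2 - a1) + N as) * nrm a1 u)"
  by (insert standing, unfold standing_assumptions_def, (elim conjE, assumption)+)

lemma banach: "a \<in> I \<Longrightarrow> banach_on (B a) (nrm a)"
  using standing_facts(1) by blast

lemma B_mono: "a1 \<in> I \<Longrightarrow> a2 \<in> I \<Longrightarrow> a1 \<le> a2 \<Longrightarrow> B a1 \<subseteq> B a2"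
  and nrm_mono: "a1 \<in> I \<Longrightarrow> a2 \<in> I \<Longrightarrow> a1 \<le> a2 \<Longrightarrow> u \<in> B a1 \<Longrightarrow> nrm a2 u \<le> nrm a1 u"
  using standing_facts(2) by blast+

lemma D_C: "a \<in> I \<Longrightarrow> D a \<subseteq> C a"
  and C_B: "a \<in> I \<Longrightarrow> C a \<subseteq> B a"
  using standing_facts(3) unfolding closed_subspace_in_def by blast+

lemma generator: "a \<in> I \<Longrightarrow> is_generator (C a) (nrm a) (S a) A (D a)"
  using standing_facts(5) by blast

lemma B_D: "a1 \<in> I \<Longrightarrow> a \<in> I \<Longrightarrow> a1 < a \<Longrightarrow> B a1 \<subseteq> D a"
  and S_consistent: "a1 \<in> I \<Longrightarrow> a \<in> I \<Longrightarrow> a1 < a \<Longrightarrow> 0 \<le> t \<Longrightarrow> x \<in> B a1 \<Longrightarrow> S a t x = S a1 t x"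
  using standing_facts(6) by blast+

lemma S_growth: "a \<in> I \<Longrightarrow> 0 \<le> t \<Longrightarrow> x \<in> C a \<Longrightarrow> nrm a (S a t x) \<le> \<nu> * exp (\<omega> * t) * nrm a x"
  using standing_facts(8) by blast

lemma M_pos: "a \<in> I \<Longrightarrow> M a > 0"
  and N_pos: "a \<in> I \<Longrightarrow> N a > 0"
  using standing_facts(9) by blast+

lemma Z_maps: "a \<in> I \<Longrightarrow> aL < a1 \<Longrightarrow> a1 < a2 \<Longrightarrow> a2 \<le> a \<Longrightarrow> u \<in> B a1 \<Longrightarrow> Z u \<in> B a2"
  and Z_norm: "a \<in> I \<Longrightarrow> aL < a1 \<Longrightarrow> a1 < a2 \<Longrightarrow> a2 \<le> a \<Longrightarrow> u \<in> B a1 \<Longrightarrow>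
    nrm a2 (Z u) \<le> (M a / (a2 - a1) + N a) * nrm a1 u"
  using standing_facts(11) by blast+

lemma normed_B: "a \<in> I \<Longrightarrow> normed_subspace (B a) (nrm a)"
  using banach by (auto simp: banach_on_def normed_subspace_def)

lemma semigroup: "a \<in> I \<Longrightarrow> C0_semigroup (C a) (nrm a) (S a)"
  using generator by (auto simp: is_generator_def)

lemma S_closed: "a \<in> I \<Longrightarrow> 0 \<le> t \<Longrightarrow> x \<in> C a \<Longrightarrow> S a t x \<in> C a"
  using semigroup unfolding C0_semigroup_def by blast

lemma B_C: "a1 \<in> I \<Longrightarrow> a \<in> I \<Longrightarrow> a1 < a \<Longrightarrow> B a1 \<subseteq> C a"
  using B_D D_C by blast

lemma A_maps: "a1 \<in> I \<Longrightarrow> a \<in> I \<Longrightarrow> a1 < a \<Longrightarrow> x \<in> B a1 \<Longrightarrow> A x \<in> B a"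
  using generator[of a] B_D[of a1 a] C_B[of a] unfolding is_generator_def by blast

lemma A_derivative: "a1 \<in> I \<Longrightarrow> a \<in> I \<Longrightarrow> a1 < a \<Longrightarrow> x \<in> B a1 \<Longrightarrow>
    tends_in (nrm a) (\<lambda>h. inverse h *\<^sub>R (S a h x - x)) (A x) (at_right 0)"
  using generator[of a] B_D[of a1 a] unfolding is_generator_def by blast

lemma norm_on_subset: "norm_on X f \<Longrightarrow> Y \<subseteq> X \<Longrightarrow> norm_on Y f"
  unfolding norm_on_def by (simp add: subset_iff)

lemma linear_on_subset: "linear_on X f \<Longrightarrow> Y \<subseteq> X \<Longrightarrow> linear_on Y f"
  unfolding linear_on_def by blast

text \<open>Only \<open>B a1 \<subseteq> D a2\<close> is assumed; boundedness of \<open>A\<close> comes from the Banach-Steinhaus theorem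
  applied to the difference quotients of the semigroup.\<close>

lemma A_bounded:
  assumes a: "a1 \<in> I" "a2 \<in> I" "a1 < a2"
  shows "\<exists>K. \<forall>x\<in>B a1. nrm a2 (A x) \<le> K * nrm a1 x"
proof -
  interpret normed_subspace "B a2" "nrm a2" using a by (intro normed_B)
  interpret a1: normed_subspace "B a1" "nrm a1" using a by (intro normed_B)
  define h :: "nat \<Rightarrow> real" where "h j = inverse (real (Suc j))" for j
  define Q where "Q j x = inverse (h j) *\<^sub>R (S a2 (h j) x - x)" for j x
  have h: "h j > 0" for j by (simp add: h_def)
  have xC: "x \<in> C a2" and x2: "x \<in> B a2" and Sx: "S a2 (h j) x \<in> B a2" if "x \<in> B a1" for x j
    using B_C[OF a] B_mono[OF a(1,2)] S_closed[OF a(2), of "h j" x] C_B[OF a(2)] a(3) h[of j] that by auto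
  have Q_mem: "Q j x \<in> B a2" if "x \<in> B a1" for j x
    unfolding Q_def using that by (intro mem Sx x2)
  have "linear_on (C a2) (S a2 (h j))" for j
    using semigroup[OF a(2)] h[of j] unfolding C0_semigroup_def by simp
  then have "linear_on (B a1) (S a2 (h j))" for j using B_C[OF a] by (rule linear_on_subset)
  then have Q_linear: "linear_on (B a1) (Q j)" for j
    unfolding Q_def linear_on_def by (simp add: algebra_simps)
  \<comment> \<open>The constant found here contains \<open>inverse (h j)\<close> and is useless for
    large \<open>j\<close>; it only provides the continuity of each single quotient that the uniform
    boundedness principle requires.\<close>
  have Q_bounded: "\<exists>K. \<forall>x\<in>B a1. nrm a2 (Q j x) \<le> K * nrm a1 x" for j
  proof (intro exI ballI)
    fix x assume x: "x \<in> B a1"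
    have "nrm a2 (Q j x) = inverse (h j) * nrm a2 (S a2 (h j) x - x)"
      unfolding Q_def using x h[of j] by (subst n_scale) (auto intro: mem Sx x2)
    also have "nrm a2 (S a2 (h j) x - x) \<le> nrm a2 (S a2 (h j) x) + nrm a2 x"
      using x by (intro triangle_diff Sx x2)
    also have "nrm a2 (S a2 (h j) x) \<le> \<nu> * exp (\<omega> * h j) * nrm a2 x"
      using h[of j] x by (intro S_growth a xC) auto
    also have "\<nu> * exp (\<omega> * h j) * nrm a2 x + nrm a2 x = (\<nu> * exp (\<omega> * h j) + 1) * nrm a2 x"
      by (simp add: algebra_simps)
    also have "\<dots> \<le> (\<nu> * exp (\<omega> * h j) + 1) * nrm a1 x"
      using nu_ge_1 a x by (intro mult_left_mono nrm_mono) auto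
    finally show "nrm a2 (Q j x) \<le> (inverse (h j) * (\<nu> * exp (\<omega> * h j) + 1)) * nrm a1 x"
      using h[of j] by (simp add: mult_left_mono mult.assoc)
  qed
  have "filterlim h (at_right 0) sequentially"
    unfolding h_def by (intro tendsto_imp_filterlim_at_right LIMSEQ_inverse_real_of_nat) (simp del: of_nat_Suc)
  then have Q_lim: "tends_in (nrm a2) (\<lambda>j. Q j x) (A x) sequentially" if "x \<in> B a1" for x
    using A_derivative[OF a that] unfolding tends_in_def Q_def
    by (auto elim: eventually_compose_filterlim)
  have Q_pointwise: "\<exists>K. \<forall>j. nrm a2 (Q j x) \<le> K" if x: "x \<in> B a1" for x
  proof -
    have Ax: "A x \<in> B a2" by (rule A_maps[OF a x])
    obtain J where J: "\<And>j. j \<ge> J \<Longrightarrow> nrm a2 (Q j x - A x) < 1"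
      using Q_lim[OF x] unfolding tends_in_def eventually_sequentially by (meson zero_less_one)
    \<comment> \<open>The sum dominates the finitely many early quotients, the other term those
      within distance 1 of the limit.\<close>
    define K where "K = (\<Sum>j<J. nrm a2 (Q j x)) + (1 + nrm a2 (A x))"
    have "nrm a2 (Q j x) \<le> K" for j
    proof (cases "j < J")
      case True
      then have "nrm a2 (Q j x) \<le> (\<Sum>j<J. nrm a2 (Q j x))"
        by (intro member_le_sum nonneg Q_mem x) auto
      then show ?thesis using nonneg[OF Ax] by (simp add: K_def)
    next
      case False
      have "nrm a2 (Q j x) \<le> nrm a2 (Q j x - A x) + nrm a2 (A x)"
        using triangle[of "Q j x - A x" "A x"] Ax Q_mem[OF x] by (simp add: mem)
      moreover have "0 \<le> (\<Sum>j<J. nrm a2 (Q j x))" by (intro sum_nonneg nonneg Q_mem x)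
      ultimately show ?thesis using J[of j] False by (simp add: K_def)
    qed
    then show ?thesis by blast
  qed
  obtain K where K: "\<And>j x. x \<in> B a1 \<Longrightarrow> nrm a2 (Q j x) \<le> K * nrm a1 x"
    using uniform_boundedness[OF banach[OF a(1)] normed_B[OF a(2)] Q_mem Q_linear Q_bounded Q_pointwise] by blast
  have "nrm a2 (A x) \<le> K * nrm a1 x" if x: "x \<in> B a1" for x
  proof -
    have Ax: "A x \<in> B a2" by (rule A_maps[OF a x])
    have "nrm a2 (0 - A x) \<le> K * nrm a1 x"
      by (rule limit_le[OF Q_lim[OF x] Q_mem[OF x] Ax zero_mem tendsto_const])
        (use K[OF x] n_minus[OF Q_mem[OF x]] in simp)
    then show ?thesis using n_minus[OF Ax] by simp
  qed
  then show ?thesis by blast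
qed

text \<open>Every vector of the intersection also lies in a space strictly below any given index
  \<open>a\<close>, hence in \<open>C a\<close>, and there \<open>S hi\<close> coincides with
  \<open>S a\<close>. The growth bound and the generator property are therefore inherited in every
  norm.\<close>

lemma perturbed_scale:
  assumes hi: "hi \<in> I" and lo: "aL < lo" "lo < hi"
  shows "perturbed_scale (\<Inter>a\<in>{lo<..hi}. B a) nrm lo hi (S hi) A \<nu> \<omega> Z (M hi) (N hi)"
proof -
  define X where "X = (\<Inter>a\<in>{lo<..hi}. B a)"
  have J: "a \<in> I" if "a \<in> {lo<..hi}" for a
    using that hi lo by (auto simp: Iint_def intro: le_less_trans[of "ereal a" "ereal hi"])
  have XB: "x \<in> B a" if "x \<in> X" "a \<in> {lo<..hi}" for x a using that by (auto simp: X_def)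
  have XI: "x \<in> X" if "\<And>a. a \<in> {lo<..hi} \<Longrightarrow> x \<in> B a" for x using that by (auto simp: X_def)
  \<comment> \<open>The openness at \<open>lo\<close> is used here: the inclusion in
    \<open>C a\<close> and the invariance under \<open>A\<close> and \<open>Z\<close> rest on a
    smaller index being available.\<close>
  have between: "\<exists>b\<in>{lo<..hi}. b < a" if "a \<in> {lo<..hi}" for a
    using that by (intro bexI[of _ "(lo + a) / 2"]) auto
  have XC: "x \<in> C a" if x: "x \<in> X" and a: "a \<in> {lo<..hi}" for x a
    using between[OF a] B_C[OF J J[OF a]] XB[OF x] by blast
  have S_eq: "S hi t x = S a t x" if "x \<in> X" "a \<in> {lo<..hi}" "0 \<le> t" for x a t
  proof (cases "a = hi")
    case False
    then show ?thesis using that by (intro S_consistent J hi XB) auto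
  qed simp
  have X_Un: "X \<subseteq> (\<Union>a\<in>I. B a)" using XB[of _ hi] lo hi by auto
  have sub: "subspace_on X"
    using normed_subspace.subspace[OF normed_B[OF J]] unfolding subspace_on_def X_def by blast
  have Xhi: "X \<subseteq> C hi" using XC[of _ hi] lo by auto
  have nS: "normed_subspace X (nrm a)" if a: "a \<in> {lo<..hi}" for a
  proof
    show "subspace_on X" by fact
    show "norm_on X (nrm a)"
      using normed_subspace.norm[OF normed_B[OF J[OF a]]] by (rule norm_on_subset) (use XB[OF _ a] in blast)
  qed
  have "perturbed_scale X nrm lo hi (S hi) A \<nu> \<omega> Z (M hi) (N hi)"
  proof (intro perturbed_scale.intro semigroup_scale.intro perturbed_scale_axioms.intro)
    show "lo < hi" "\<nu> \<ge> 1" "M hi > 0" "N hi > 0" using lo nu_ge_1 hi by (auto intro: M_pos N_pos)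
    show "normed_subspace X (nrm a)" if "a \<in> {lo<..hi}" for a by (rule nS[OF that])
    show "linear_on X A" "linear_on X Z"
      using linear_on_subset[OF linear_A X_Un] linear_on_subset[OF linear_Z X_Un] by auto
    show "A x \<in> X" if x: "x \<in> X" for x
    proof (rule XI)
      fix a assume a: "a \<in> {lo<..hi}"
      then obtain b where "b \<in> {lo<..hi}" "b < a" using between by blast
      then show "A x \<in> B a" using a x by (intro A_maps[of b a] J XB) auto
    qed
    show "Z x \<in> X" if x: "x \<in> X" for x
    proof (rule XI)
      fix a assume a: "a \<in> {lo<..hi}"
      then obtain b where b: "b \<in> {lo<..hi}" "b < a" using between by blast
      then show "Z x \<in> B a" using a x lo by (intro Z_maps[of hi b a] hi XB) auto
    qed
    show "nrm b (Z x) \<le> (M hi / (b - a) + N hi) * nrm a x"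
      if "lo < a" "a < b" "b \<le> hi" "x \<in> X" for a b x
      using that lo by (intro Z_norm hi XB) auto
    show "nrm b x \<le> nrm a x" if "lo < a" "a \<le> b" "b \<le> hi" "x \<in> X" for a b x
      using that by (intro nrm_mono J XB) auto
    show "\<exists>K. \<forall>x\<in>X. nrm b (A x) \<le> K * nrm a x" if "lo < a" "a < b" "b \<le> hi" for a b
      using A_bounded[of a b] J[of a] J[of b] XB[of _ a] that by fastforce
    show "tends_in (nrm a) (\<lambda>h. inverse h *\<^sub>R (S hi h x - x)) (A x) (at_right 0)"
      if a: "a \<in> {lo<..hi}" and x: "x \<in> X" for a x
    proof -
      obtain b where b: "b \<in> {lo<..hi}" "b < a" using between a by blast
      have "tends_in (nrm a) (\<lambda>h. inverse h *\<^sub>R (S a h x - x)) (A x) (at_right 0)"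
        using b by (intro A_derivative[of b] J a XB x)
      moreover have "\<forall>\<^sub>F h in at_right 0. S hi h x = S a h x"
        using S_eq[OF x a] by (auto simp: eventually_at_right_field intro!: exI[of _ 1])
      ultimately show ?thesis
        unfolding tends_in_def
      proof (intro allI impI)
        fix e :: real assume eq: "\<forall>\<^sub>F h in at_right 0. S hi h x = S a h x"
          and "\<forall>e>0. \<forall>\<^sub>F h in at_right 0. nrm a (inverse h *\<^sub>R (S a h x - x) - A x) < e" "e > 0"
        then have "\<forall>\<^sub>F h in at_right 0. nrm a (inverse h *\<^sub>R (S a h x - x) - A x) < e" by blast
        with eq show "\<forall>\<^sub>F h in at_right 0. nrm a (inverse h *\<^sub>R (S hi h x - x) - A x) < e"
          by eventually_elim simp
      qed
    qed
    show "S hi t x \<in> X" if t: "0 \<le> t" and x: "x \<in> X" for t x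
    proof (rule XI)
      fix a assume a: "a \<in> {lo<..hi}"
      show "S hi t x \<in> B a"
        unfolding S_eq[OF x a t] using S_closed[OF J[OF a] t XC[OF x a]] C_B[OF J[OF a]] by blast
    qed
    show "linear_on X (S hi t)" if "0 \<le> t" for t
      using linear_on_subset[OF _ Xhi] semigroup[OF hi] that unfolding C0_semigroup_def by blast
    show "S hi 0 x = x" if "x \<in> X" for x
      using semigroup[OF hi] that Xhi unfolding C0_semigroup_def by blast
    show "S hi (t + r) x = S hi t (S hi r x)" if "0 \<le> t" "0 \<le> r" "x \<in> X" for t r x
      using semigroup[OF hi] that Xhi unfolding C0_semigroup_def by blast
    show "nrm a (S hi t x) \<le> \<nu> * exp (\<omega> * t) * nrm a x" if "a \<in> {lo<..hi}" "0 \<le> t" "x \<in> X" for a t x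
      unfolding S_eq[OF that(3,1,2)] using that by (intro S_growth J XC)
    show "\<exists>L\<in>X. \<forall>a\<in>{lo<..hi}. tends_in (nrm a) f L sequentially"
      if f: "\<And>k. f k \<in> X" and cauchy: "\<And>a e. a \<in> {lo<..hi} \<Longrightarrow> e > 0 \<Longrightarrow> \<exists>K. \<forall>i\<ge>K. \<forall>j\<ge>K. nrm a (f i - f j) < e"
      for f :: "nat \<Rightarrow> 'v"
    proof -
      have lim: "\<exists>L\<in>B a. tends_in (nrm a) f L sequentially" if a: "a \<in> {lo<..hi}" for a
        using banach[OF J[OF a]] cauchy[OF a] XB[OF f a] unfolding banach_on_def complete_wrt_def by blast
      have hi_J: "hi \<in> {lo<..hi}" using lo by simp
      interpret hi: normed_subspace "B hi" "nrm hi" using hi by (rule normed_B)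
      obtain L where L: "L \<in> B hi" "tends_in (nrm hi) f L sequentially" using lim[OF hi_J] by blast
      \<comment> \<open>Each \<open>B a\<close> yields its own limit. Since \<open>nrm hi\<close> is
        the weakest of the norms, all of them are also limits in \<open>B hi\<close> and coincide
        there.\<close>
      have "L \<in> B a \<and> tends_in (nrm a) f L sequentially" if a: "a \<in> {lo<..hi}" for a
      proof -
        interpret a: normed_subspace "B a" "nrm a" using J[OF a] by (rule normed_B)
        obtain L' where L': "L' \<in> B a" "tends_in (nrm a) f L' sequentially" using lim[OF a] by blast
        have L'hi: "L' \<in> B hi" using B_mono[OF J[OF a] hi] a L' by auto
        have "nrm hi (f k - L') \<le> nrm a (f k - L')" for k
          using a L' by (intro nrm_mono J hi a.mem XB[OF f a]) auto
        then have "tends_in (nrm hi) f L' sequentially"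
          using L'(2) unfolding tends_in_def eventually_sequentially by (meson le_less_trans)
        then have "L = L'" using XB[OF f hi_J] by (intro hi.limit_unique[OF L(2)] L L'hi)
        with L' show ?thesis by simp
      qed
      then show ?thesis using XI by blast
    qed
  qed
  then show ?thesis by (simp add: X_def)
qed

text \<open>The series is controlled uniformly only on \<open>[0, r]\<close> with
  \<open>r < T\<close>, so the conclusions are stated for every such \<open>r\<close>, about one
  function \<open>w\<close>. Instead of a derivative the last conclusion gives the mean value
  inequality, which survives the limit; with continuity of \<open>A (w t) + Z (w t)\<close> it
  determines the derivative.\<close>

lemma unshifted_solution:
  assumes hi: "hi \<in> I" and lo: "aL < lo" "lo < hi" and x: "x \<in> B lo"
    and T: "T = Tfun \<nu> M lo hi"
  obtains w where "w 0 = x"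
    "\<And>r t. 0 \<le> r \<Longrightarrow> r < T \<Longrightarrow> t \<in> {0..r} \<Longrightarrow> w t \<in> B hi \<and> A (w t) \<in> B hi \<and> Z (w t) \<in> B hi"
    "\<And>r t e. \<lbrakk>0 \<le> r; r < T; t \<in> {0..r}; e > 0\<rbrakk>
        \<Longrightarrow> \<exists>d>0. \<forall>s\<in>{0..r}. \<bar>s - t\<bar> < d \<longrightarrow> nrm hi (w s - w t) < e"
    "\<And>r t e. \<lbrakk>0 \<le> r; r < T; t \<in> {0..r}; e > 0\<rbrakk>
        \<Longrightarrow> \<exists>d>0. \<forall>s\<in>{0..r}. \<bar>s - t\<bar> < d \<longrightarrow> nrm hi (A (w s) + Z (w s) - (A (w t) + Z (w t))) < e"
    "\<And>r s t y e. \<lbrakk>0 \<le> r; r < T; 0 \<le> s; s \<le> t; t \<le> r; y \<in> B hi;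
        \<And>q. s \<le> q \<Longrightarrow> q \<le> t \<Longrightarrow> nrm hi (A (w q) + Z (w q) - y) \<le> e\<rbrakk>
        \<Longrightarrow> nrm hi (w t - w s - (t - s) *\<^sub>R y) \<le> (t - s) * e"
proof -
  define X where "X = (\<Inter>a\<in>{lo<..hi}. B a)"
  interpret perturbed_scale X nrm lo hi "S hi" A \<nu> \<omega> Z "M hi" "N hi"
    unfolding X_def by (rule perturbed_scale[OF hi lo])
  interpret hi: normed_subspace "B hi" "nrm hi" using hi by (rule normed_B)
  have J: "a \<in> I" if "lo \<le> a" "a \<le> hi" for a
    using that hi lo by (auto simp: Iint_def intro: le_less_trans[of "ereal a" "ereal hi"])
  have X_B: "X \<subseteq> B a" if "lo < a" "a \<le> hi" for a using that by (auto simp: X_def)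
  have "x \<in> B a" if "lo < a" "a \<le> hi" for a
    using B_mono[OF J[of lo] J[of a]] x that by auto
  then have xX: "x \<in> X" by (simp add: X_def)
  have T_pos: "T > 0" using lo m_pos nu_ge_1 by (simp add: T Tfun_def)
  obtain U where U: "\<And>k. lipschitz_path T (U k)" and U_init: "\<And>N. (\<Sum>k<Suc N. U k 0) = x"
    and U_approx: "\<And>N. approx_solution T (\<lambda>t. \<Sum>k<Suc N. U k t) (\<lambda>t. A (\<Sum>k<Suc N. U k t) + Z (\<Sum>k<N. U k t))"
    and U_bound: "\<And>a b r t k. \<lbrakk>lo < a; a < b; b \<le> hi; r \<le> T; t \<in> {0..r}\<rbrakk> \<Longrightarrow>
      nrm b (U k t) \<le> (Sbound T * exp (N hi * (b - a) / M hi) * nrm a x) * (exp 1 * \<nu> * M hi * r / (b - a)) ^ k"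
    using perturbed_series[OF xX, of T] T_pos by auto
  define V where "V N t = (\<Sum>k<N. U k t)" for N t
  define g where "g N t = A (V (Suc N) t) + Z (V N t)" for N t
  have V_lip: "lipschitz_path T (V N)" for N unfolding V_def by (rule lipschitz_path_sum[OF U])
  have g_lip: "lipschitz_path T (g N)" for N
    unfolding g_def by (intro lipschitz_path_add lipschitz_path_A lipschitz_path_Z V_lip)
  have V_X: "V N t \<in> X" and g_X: "g N t \<in> X" if "t \<in> {0..T}" for N t
    using lipschitz_path_mem[OF V_lip that] lipschitz_path_mem[OF g_lip that] by auto
  have hi_J: "hi \<in> {lo<..hi}" using lo by simp
  have lip_hi: "\<exists>L\<ge>0. \<forall>s\<in>{0..r}. \<forall>t\<in>{0..r}. nrm hi (f s - f t) \<le> L * \<bar>s - t\<bar>"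
    if f: "lipschitz_path T f" "r < T" for f r
  proof -
    obtain L where "L \<ge> 0" "\<forall>s\<in>{0..T}. \<forall>t\<in>{0..T}. nrm hi (f s - f t) \<le> L * \<bar>s - t\<bar>"
      using f(1) hi_J unfolding lipschitz_path_def by blast
    then show ?thesis using f(2) by (intro exI[of _ L]) auto
  qed
  have geometric: "\<exists>b G q. lo < b \<and> b < hi \<and> 0 \<le> q \<and> q < 1 \<and> (\<forall>t\<in>{0..r}. \<forall>k. nrm b (U k t) \<le> G * q ^ k)"
    if r: "0 \<le> r" "r < T" for r
  proof -
    define c where "c = exp 1 * \<nu> * M hi"
    have c: "c > 0" using m_pos nu_ge_1 by (simp add: c_def)
    have cr: "c * r < hi - lo" using r(2) c by (simp add: T Tfun_def c_def field_simps)
    \<comment> \<open>The slack left by \<open>r < T\<close> is cut into three. One part lifts the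
      starting index above \<open>lo\<close>, where the norms on \<open>X\<close> live; one keeps
      the final index below \<open>hi\<close>, so that \<open>A\<close> and \<open>Z\<close> are
      bounded from there into \<open>B hi\<close>; the third makes the ratio strictly less than
      1.\<close>
    define \<eta> where "\<eta> = (hi - lo - c * r) / 3"
    have \<eta>: "\<eta> > 0" "3 * \<eta> = hi - lo - c * r" using cr by (auto simp: \<eta>_def)
    have "c * r \<ge> 0" using c r by simp
    with \<eta> have ab: "lo < lo + \<eta>" "lo + \<eta> < hi - \<eta>" "hi - \<eta> < hi" "lo < hi - \<eta>"
      and gap: "c * r < (hi - \<eta>) - (lo + \<eta>)" by linarith+
    have "nrm (hi - \<eta>) (U k t) \<le> (Sbound T * exp (N hi * ((hi - \<eta>) - (lo + \<eta>)) / M hi) * nrm (lo + \<eta>) x)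
        * (c * r / ((hi - \<eta>) - (lo + \<eta>))) ^ k" if "t \<in> {0..r}" for k t
      unfolding c_def using ab r that by (intro U_bound) auto
    moreover have "0 \<le> c * r / ((hi - \<eta>) - (lo + \<eta>))" "c * r / ((hi - \<eta>) - (lo + \<eta>)) < 1"
      using gap \<open>c * r \<ge> 0\<close> by auto
    ultimately show ?thesis using ab by blast
  qed
  \<comment> \<open>The limit is taken in \<open>nrm hi\<close> because the better index
    \<open>b\<close> found above depends on \<open>r\<close>. Uniqueness in \<open>B hi\<close> then
    identifies \<open>w t\<close> with the limit in \<open>B b\<close>, for each
    \<open>r\<close>.\<close>
  define w where "w t = (SOME L. L \<in> B hi \<and> tends_in (nrm hi) (\<lambda>N. V N t) L sequentially)" for t
  have conv: "\<exists>b c. lo < b \<and> b < hi \<and> c \<longlonglongrightarrow> 0 \<and> (\<forall>t\<in>{0..r}. w t \<in> B b \<and> (\<forall>N. nrm b (w t - V N t) \<le> c N))"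
    if r: "0 \<le> r" "r < T" for r
  proof -
    obtain b G q where b: "lo < b" "b < hi" and q: "0 \<le> q" "q < 1"
      and G: "\<And>t k. t \<in> {0..r} \<Longrightarrow> nrm b (U k t) \<le> G * q ^ k"
      using geometric[OF r] by blast
    interpret b: normed_subspace "B b" "nrm b" using b by (intro normed_B J) auto
    define c where "c N = G * q ^ N / (1 - q)" for N
    have c: "c \<longlonglongrightarrow> 0"
      unfolding c_def using tendsto_mult_left[OF LIMSEQ_realpow_zero[OF q], of "G / (1 - q)"] by simp
    have "w t \<in> B b \<and> (\<forall>N. nrm b (w t - V N t) \<le> c N)" if t: "t \<in> {0..r}" for t
    proof -
      have tT: "t \<in> {0..T}" using t r by auto
      have "U k t \<in> B b" for k using X_B[of b] b lipschitz_path_mem[OF U tT] by auto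
      then obtain L where L: "L \<in> B b" "\<And>N. nrm b (L - V N t) \<le> c N"
        using geometric_series_converges[OF banach[OF J, of b] _ G[OF t] q] b unfolding V_def c_def by auto
      have V_mem: "V N t \<in> B b" "V N t \<in> B hi" for N
        using subsetD[OF X_B V_X[OF tT], of b] subsetD[OF X_B V_X[OF tT], of hi] b lo by auto
      have L_hi: "L \<in> B hi" using B_mono[OF J hi, of b] b L by auto
      have V_le: "nrm hi (V N t - L) \<le> c N" for N
        using nrm_mono[OF J hi, of b "V N t - L"] b b.diff_mem[OF V_mem(1) L(1)] L(2)[of N]
          b.diff_commute[OF V_mem(1) L(1), of N] by simp
      have L_lim: "tends_in (nrm hi) (\<lambda>N. V N t) L sequentially"
        unfolding tends_in_def
      proof (intro allI impI)
        fix e :: real assume "e > 0"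
        then have "\<forall>\<^sub>F N in sequentially. c N < e" by (rule order_tendstoD(2)[OF c])
        then show "\<forall>\<^sub>F N in sequentially. nrm hi (V N t - L) < e"
          by (rule eventually_mono) (rule le_less_trans[OF V_le])
      qed
      have "w t \<in> B hi \<and> tends_in (nrm hi) (\<lambda>N. V N t) (w t) sequentially"
        unfolding w_def
        by (intro someI[of "\<lambda>L. L \<in> B hi \<and> tends_in (nrm hi) (\<lambda>N. V N t) L sequentially" L] conjI L_hi L_lim)
      then have "w t = L" using hi.limit_unique[OF _ L_lim V_mem(2) _ L_hi] by blast
      with L show ?thesis by simp
    qed
    with b c show ?thesis by blast
  qed
  have limits: "\<exists>c. c \<longlonglongrightarrow> 0 \<and> (\<forall>t\<in>{0..r}. w t \<in> B hi \<and> A (w t) \<in> B hi \<and> Z (w t) \<in> B hi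
      \<and> (\<forall>N. nrm hi (w t - V N t) \<le> c N \<and> nrm hi (A (w t) + Z (w t) - g N t) \<le> c N))"
    if r: "0 \<le> r" "r < T" for r
  proof -
    obtain b c where b: "lo < b" "b < hi" and c: "c \<longlonglongrightarrow> 0"
      and w: "\<And>t. t \<in> {0..r} \<Longrightarrow> w t \<in> B b" "\<And>t N. t \<in> {0..r} \<Longrightarrow> nrm b (w t - V N t) \<le> c N"
      using conv[OF r] by blast
    have bI: "b \<in> I" using b by (intro J) auto
    interpret b: normed_subspace "B b" "nrm b" using bI by (rule normed_B)
    obtain KA where KA: "\<And>y. y \<in> B b \<Longrightarrow> nrm hi (A y) \<le> KA * nrm b y"
      using A_bounded[OF bI hi b(2)] by blast
    define KZ where "KZ = M hi / (hi - b) + N hi"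
    have KZ: "nrm hi (Z y) \<le> KZ * nrm b y" "Z y \<in> B hi" if "y \<in> B b" for y
      unfolding KZ_def using Z_norm[OF hi, of b hi y] Z_maps[OF hi, of b hi y] that b lo by auto
    have KZ_pos: "KZ > 0" using m_pos n_pos b by (simp add: KZ_def add_pos_pos)
    \<comment> \<open>One null sequence for the error of \<open>V N\<close> and that of
      \<open>g N\<close>; the shifted term appears because \<open>g N\<close> applies
      \<open>A\<close> to \<open>V (Suc N)\<close>.\<close>
    define c' where "c' N = c N + (\<bar>KA\<bar> * c (Suc N) + KZ * c N)" for N
    have "c' \<longlonglongrightarrow> 0 + (\<bar>KA\<bar> * 0 + KZ * 0)"
      unfolding c'_def by (intro tendsto_intros c LIMSEQ_Suc[OF c])
    then have c': "c' \<longlonglongrightarrow> 0" by simp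
    have "w t \<in> B hi \<and> A (w t) \<in> B hi \<and> Z (w t) \<in> B hi
      \<and> (\<forall>N. nrm hi (w t - V N t) \<le> c' N \<and> nrm hi (A (w t) + Z (w t) - g N t) \<le> c' N)" if t: "t \<in> {0..r}" for t
    proof -
      have tT: "t \<in> {0..T}" using t r by auto
      have V_mem: "V N t \<in> B b" for N
        using subsetD[OF X_B V_X[OF tT], of b] b by auto
      have diff: "w t - V N t \<in> B b" for N by (intro b.diff_mem w(1)[OF t] V_mem)
      have c0: "c N \<ge> 0" for N using b.nonneg[OF diff] w(2)[OF t] by (rule order_trans)
      have B_Un: "B b \<subseteq> (\<Union>a\<in>I. B a)" using bI by blast
      have A_diff: "A (w t) - A (V N t) = A (w t - V N t)" and Z_diff: "Z (w t) - Z (V N t) = Z (w t - V N t)" for N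
        using linear_on_diff[OF linear_on_subset[OF linear_A B_Un] b.subspace w(1)[OF t] V_mem]
          linear_on_diff[OF linear_on_subset[OF linear_Z B_Un] b.subspace w(1)[OF t] V_mem] by auto
      have A_le: "nrm hi (A (w t) - A (V N t)) \<le> \<bar>KA\<bar> * c N" for N
      proof -
        have "nrm hi (A (w t) - A (V N t)) \<le> KA * nrm b (w t - V N t)" unfolding A_diff by (rule KA[OF diff])
        also have "\<dots> \<le> \<bar>KA\<bar> * c N" using b.nonneg[OF diff] by (intro mult_mono w(2)[OF t]) auto
        finally show ?thesis .
      qed
      have Z_le: "nrm hi (Z (w t) - Z (V N t)) \<le> KZ * c N" for N
      proof -
        have "nrm hi (Z (w t) - Z (V N t)) \<le> KZ * nrm b (w t - V N t)" unfolding Z_diff by (rule KZ(1)[OF diff])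
        also have "\<dots> \<le> KZ * c N" using KZ_pos by (intro mult_left_mono w(2)[OF t]) auto
        finally show ?thesis .
      qed
      have mems: "A y \<in> B hi" "Z y \<in> B hi" if "y \<in> B b" for y
        using A_maps[OF bI hi b(2) that] KZ(2)[OF that] by auto
      have w_hi: "w t \<in> B hi" using B_mono[OF bI hi] b w(1)[OF t] by auto
      moreover have "nrm hi (w t - V N t) \<le> c' N" for N
      proof -
        have "nrm hi (w t - V N t) \<le> c N"
          using nrm_mono[OF bI hi _ diff] w(2)[OF t, of N] b by (meson less_imp_le order_trans)
        then show ?thesis using c0[of N] c0[of "Suc N"] KZ_pos by (simp add: c'_def add_increasing2)
      qed
      moreover have "nrm hi (A (w t) + Z (w t) - g N t) \<le> c' N" for N
      proof -
        have eq: "A (w t) + Z (w t) - g N t = (A (w t) - A (V (Suc N) t)) + (Z (w t) - Z (V N t))"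
          by (simp add: g_def)
        have "nrm hi (A (w t) + Z (w t) - g N t) \<le> nrm hi (A (w t) - A (V (Suc N) t)) + nrm hi (Z (w t) - Z (V N t))"
          unfolding eq by (intro hi.triangle hi.diff_mem mems w(1)[OF t] V_mem)
        then show ?thesis using A_le[of "Suc N"] Z_le[of N] c0[of N] by (simp add: c'_def)
      qed
      ultimately show ?thesis using mems[OF w(1)[OF t]] by blast
    qed
    with c' show ?thesis by blast
  qed
  have maps: "w t \<in> B hi \<and> A (w t) \<in> B hi \<and> Z (w t) \<in> B hi" if "0 \<le> r" "r < T" "t \<in> {0..r}" for r t
    using limits[OF that(1,2)] that(3) by blast
  have VB: "V N t \<in> B hi" and gB: "g N t \<in> B hi" if "t \<in> {0..r}" "r < T" for N t r
    using subsetD[OF X_B V_X[of t N], of hi] subsetD[OF X_B g_X[of t N], of hi] lo that by auto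
  show ?thesis
  proof (rule that[of w])
    show "w 0 = x"
    proof -
      obtain c where c: "c \<longlonglongrightarrow> 0" "\<And>N. nrm hi (w 0 - V N 0) \<le> c N" "w 0 \<in> B hi"
        using limits[of 0] T_pos by auto
      \<comment> \<open>The partial sums equal \<open>x\<close> at time 0 only from one term on; the
        empty sum is 0.\<close>
      have "nrm hi (w 0 - x) \<le> c (Suc N)" for N using c(2)[of "Suc N"] U_init[of N] by (simp only: V_def)
      then have "nrm hi (w 0 - x) \<le> 0" by (intro LIMSEQ_le_const[OF LIMSEQ_Suc[OF c(1)]]) auto
      moreover have "x \<in> B hi" using xX X_B[of hi] lo by auto
      ultimately show ?thesis
        using hi.nonneg[of "w 0 - x"] hi.eq_zero_iff[of "w 0 - x"] c(3) by (simp add: hi.mem)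
    qed
  next
    fix r t e :: real assume r: "0 \<le> r" "r < T" and t: "t \<in> {0..r}" and e: "e > 0"
    obtain c where c: "c \<longlonglongrightarrow> 0" "\<And>t N. t \<in> {0..r} \<Longrightarrow> nrm hi (w t - V N t) \<le> c N"
      "\<And>t N. t \<in> {0..r} \<Longrightarrow> nrm hi (A (w t) + Z (w t) - g N t) \<le> c N"
      using limits[OF r] by blast
    show "\<exists>d>0. \<forall>s\<in>{0..r}. \<bar>s - t\<bar> < d \<longrightarrow> nrm hi (w s - w t) < e"
      by (rule hi.uniform_limit_continuous[where F = V and c = c])
        (use maps[OF r] VB[OF _ r(2)] c lip_hi[OF V_lip r(2)] t e in auto)
    show "\<exists>d>0. \<forall>s\<in>{0..r}. \<bar>s - t\<bar> < d \<longrightarrow> nrm hi (A (w s) + Z (w s) - (A (w t) + Z (w t))) < e"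
      by (rule hi.uniform_limit_continuous[where F = g and c = c and f = "\<lambda>t. A (w t) + Z (w t)"])
        (use maps[OF r] gB[OF _ r(2)] c lip_hi[OF g_lip r(2)] t e in \<open>auto intro: hi.add_mem\<close>)
  next
    fix r s t y e
    assume r: "0 \<le> r" "r < T" and st: "0 \<le> s" "s \<le> t" "t \<le> r" and y: "y \<in> B hi"
      and gy: "\<And>q. s \<le> q \<Longrightarrow> q \<le> t \<Longrightarrow> nrm hi (A (w q) + Z (w q) - y) \<le> e"
    obtain c where c: "c \<longlonglongrightarrow> 0" "\<And>t N. t \<in> {0..r} \<Longrightarrow> nrm hi (w t - V N t) \<le> c N"
      "\<And>t N. t \<in> {0..r} \<Longrightarrow> nrm hi (A (w t) + Z (w t) - g N t) \<le> c N"
      using limits[OF r] by blast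
    have wB: "w q \<in> B hi" "A (w q) + Z (w q) \<in> B hi" if "q \<in> {0..r}" for q
      using maps[OF r that] by (auto intro: hi.add_mem)
    have ts: "t \<in> {0..r}" "s \<in> {0..r}" using st by auto
    have "nrm hi (w t - w s - (t - s) *\<^sub>R y) \<le> (t - s) * (e + c N) + (c (Suc N) + c (Suc N))" for N
    proof -
      let ?W = "V (Suc N)"
      \<comment> \<open>This \<open>K\<close> depends on \<open>N\<close> in an uncontrolled way.
        \<open>mean_value_bound\<close> eliminates it while \<open>N\<close> is fixed, so that
        \<open>N\<close> can go to infinity afterwards.\<close>
      obtain K where K: "\<And>t d. 0 \<le> t \<Longrightarrow> 0 \<le> d \<Longrightarrow> t + d \<le> T \<Longrightarrow> nrm hi (?W (t + d) - ?W t - d *\<^sub>R g N t) \<le> K * d\<^sup>2"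
        using U_approx[of N] hi_J unfolding approx_solution_def V_def[symmetric] g_def[symmetric] by blast
      have main: "nrm hi (?W t - ?W s - (t - s) *\<^sub>R y) \<le> (t - s) * (e + c N)"
      proof (rule hi.mean_value_bound[where R = r and w = ?W and g = "g N" and K = K])
        show "nrm hi (?W (q + d) - ?W q - d *\<^sub>R g N q) \<le> K * d\<^sup>2" if "0 \<le> q" "0 \<le> d" "q + d \<le> r" for q d
          using that r by (intro K) auto
        show "nrm hi (g N q - y) \<le> e + c N" if q: "s \<le> q" "q \<le> t" for q
        proof -
          have qr: "q \<in> {0..r}" using q st by auto
          have "nrm hi (g N q - y) \<le> nrm hi (g N q - (A (w q) + Z (w q))) + nrm hi (A (w q) + Z (w q) - y)"
            by (intro hi.triangle_via gB[OF qr r(2)] wB[OF qr] y)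
          also have "nrm hi (g N q - (A (w q) + Z (w q))) = nrm hi (A (w q) + Z (w q) - g N q)"
            by (intro hi.diff_commute gB[OF qr r(2)] wB[OF qr])
          finally show ?thesis using c(3)[OF qr, of N] gy[OF q] by linarith
        qed
      qed (use VB[OF _ r(2)] gB[OF _ r(2)] y st in auto)
      have eq: "w t - w s - (t - s) *\<^sub>R y
          = (?W t - ?W s - (t - s) *\<^sub>R y) + ((w t - ?W t) - (w s - ?W s))" by simp
      have "nrm hi (w t - w s - (t - s) *\<^sub>R y)
          \<le> nrm hi (?W t - ?W s - (t - s) *\<^sub>R y) + nrm hi ((w t - ?W t) - (w s - ?W s))"
        unfolding eq by (intro hi.triangle hi.mem wB ts VB[OF _ r(2)] y)
      moreover have "nrm hi ((w t - ?W t) - (w s - ?W s)) \<le> nrm hi (w t - ?W t) + nrm hi (w s - ?W s)"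
        by (intro hi.triangle_diff hi.mem wB ts VB[OF _ r(2)])
      ultimately show ?thesis using main c(2)[OF ts(1), of "Suc N"] c(2)[OF ts(2), of "Suc N"] by linarith
    qed
    moreover have "(\<lambda>N. (t - s) * (e + c N) + (c (Suc N) + c (Suc N))) \<longlonglongrightarrow> (t - s) * (e + 0) + (0 + 0)"
      by (intro tendsto_intros c(1) LIMSEQ_Suc[OF c(1)])
    ultimately have "nrm hi (w t - w s - (t - s) *\<^sub>R y) \<le> (t - s) * (e + 0) + (0 + 0)"
      by (intro LIMSEQ_le_const) auto
    then show "nrm hi (w t - w s - (t - s) *\<^sub>R y) \<le> (t - s) * e" by simp
  qed (use maps in blast)
qed

end

section \<open>Time shift and differentiability of the solution\<close>

theorem theorem1:
  fixes aL :: real and aU :: ereal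
    and B C D :: "real \<Rightarrow> 'v::real_vector set" and nrm :: "real \<Rightarrow> 'v \<Rightarrow> real"
    and A Z :: "'v \<Rightarrow> 'v" and S :: "real \<Rightarrow> real \<Rightarrow> 'v \<Rightarrow> 'v"
    and \<nu> \<omega> :: real and M N :: "real \<Rightarrow> real"
    and astar s as T :: real and us :: 'v
  assumes "standing_assumptions aL aU B nrm C D A S \<nu> \<omega> M N Z"
    and "astar \<in> Iint aL aU" and "s \<ge> 0"
    and "aL < as" and "as < astar"
    and "T = Tfun \<nu> M as astar"
    and "us \<in> B as"
  shows "\<exists>u::real \<Rightarrow> 'v.
     (\<forall>t\<in>{s..<s+T}. u t \<in> B astar)
   \<and> (\<forall>t\<in>{s..<s+T}. tends_in (nrm astar) u (u t) (at t within {s..<s+T}))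
   \<and> (\<exists>u'::real \<Rightarrow> 'v.
        (\<forall>t\<in>{s<..<s+T}. u' t \<in> B astar
            \<and> tends_in (nrm astar) (\<lambda>r. inverse (r - t) *\<^sub>R (u r - u t)) (u' t) (at t))
      \<and> (\<forall>t\<in>{s<..<s+T}. tends_in (nrm astar) u' (u' t) (at t within {s<..<s+T}))
      \<and> (\<forall>t\<in>{s<..<s+T}. A (u t) \<in> B astar \<and> Z (u t) \<in> B astar)
      \<and> (\<forall>t\<in>{s<..<s+T}. u' t = A (u t) + Z (u t)))
   \<and> u s = us"
proof -
  interpret standing aL aU B C D nrm A Z S \<nu> \<omega> M N using assms(1) by (rule standing.intro)
  let ?p = "nrm astar"
  interpret normed_subspace "B astar" ?p using assms(2) by (rule normed_B)
  obtain w where w0: "w 0 = us"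
    and maps: "\<And>r t. 0 \<le> r \<Longrightarrow> r < T \<Longrightarrow> t \<in> {0..r} \<Longrightarrow> w t \<in> B astar \<and> A (w t) \<in> B astar \<and> Z (w t) \<in> B astar"
    and w_cont: "\<And>r t e. \<lbrakk>0 \<le> r; r < T; t \<in> {0..r}; e > 0\<rbrakk>
        \<Longrightarrow> \<exists>d>0. \<forall>s\<in>{0..r}. \<bar>s - t\<bar> < d \<longrightarrow> ?p (w s - w t) < e"
    and g_cont: "\<And>r t e. \<lbrakk>0 \<le> r; r < T; t \<in> {0..r}; e > 0\<rbrakk>
        \<Longrightarrow> \<exists>d>0. \<forall>s\<in>{0..r}. \<bar>s - t\<bar> < d \<longrightarrow> ?p (A (w s) + Z (w s) - (A (w t) + Z (w t))) < e"
    and mean_value: "\<And>r s t y e. \<lbrakk>0 \<le> r; r < T; 0 \<le> s; s \<le> t; t \<le> r; y \<in> B astar;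
        \<And>q. s \<le> q \<Longrightarrow> q \<le> t \<Longrightarrow> ?p (A (w q) + Z (w q) - y) \<le> e\<rbrakk>
        \<Longrightarrow> ?p (w t - w s - (t - s) *\<^sub>R y) \<le> (t - s) * e"
  proof (rule unshifted_solution[OF assms(2,4,5,7,6)], goal_cases)
    case (1 w)
    from 1(2-6) show ?case by (rule 1(1))
  qed
  \<comment> \<open>The equation is autonomous, so the solution started at time 0 only has to be
    translated.\<close>
  define u where "u t = w (t - s)" for t
  define u' where "u' t = A (u t) + Z (u t)" for t
  \<comment> \<open>An endpoint strictly beyond \<open>t - s\<close> but before \<open>T\<close>: a
    right neighbourhood of \<open>t - s\<close> then lies in \<open>[0, r]\<close>, where the
    uniform estimates hold.\<close>
  have middle: "\<exists>r. 0 \<le> r \<and> r < T \<and> t - s < r \<and> t - s \<in> {0..r}" if "t \<in> {s..<s+T}" for t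
    using that by (intro exI[of _ "(t - s + T) / 2"]) auto
  have near: "\<exists>d>0. \<forall>q\<in>{s..<s+T}. \<bar>q - t\<bar> < d \<longrightarrow> ?p (f (q - s) - f (t - s)) < e"
    if t: "t \<in> {s..<s+T}" and e: "e > 0"
      and f: "\<And>r t e. \<lbrakk>0 \<le> r; r < T; t \<in> {0..r}; e > 0\<rbrakk>
        \<Longrightarrow> \<exists>d>0. \<forall>s\<in>{0..r}. \<bar>s - t\<bar> < d \<longrightarrow> ?p (f s - f t) < e" for f t e
  proof -
    obtain r where r: "0 \<le> r" "r < T" "t - s < r" "t - s \<in> {0..r}" using middle[OF t] by blast
    obtain d where d: "d > 0" "\<forall>q\<in>{0..r}. \<bar>q - (t - s)\<bar> < d \<longrightarrow> ?p (f q - f (t - s)) < e"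
      using f[OF r(1,2,4) e] by blast
    show ?thesis
    proof (intro exI[of _ "min d (r - (t - s))"] conjI ballI impI)
      fix q assume "q \<in> {s..<s+T}" "\<bar>q - t\<bar> < min d (r - (t - s))"
      then have "q - s \<in> {0..r}" "\<bar>q - s - (t - s)\<bar> < d" by auto
      then show "?p (f (q - s) - f (t - s)) < e" using d(2) by blast
    qed (use d r in auto)
  qed
  have in_B: "u t \<in> B astar" "A (u t) \<in> B astar" "Z (u t) \<in> B astar" if "t \<in> {s..<s+T}" for t
    using middle[OF that] maps unfolding u_def by blast+
  have u'_B: "u' t \<in> B astar" if "t \<in> {s..<s+T}" for t
    unfolding u'_def using in_B[OF that] by (intro add_mem)
  have u_cont: "tends_in ?p u (u t) (at t within {s..<s+T})" if t: "t \<in> {s..<s+T}" for t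
    unfolding tends_in_def eventually_at
    using near[OF t, of _ w] w_cont unfolding u_def dist_real_def by blast
  have u'_near: "\<exists>d>0. \<forall>q\<in>{s..<s+T}. \<bar>q - t\<bar> < d \<longrightarrow> ?p (u' q - u' t) < e" if "t \<in> {s..<s+T}" "e > 0" for t e
    using near[OF that, of "\<lambda>t. A (w t) + Z (w t)"] g_cont unfolding u'_def u_def by blast
  have u'_cont: "tends_in ?p u' (u' t) (at t within {s<..<s+T})" if t: "t \<in> {s<..<s+T}" for t
    unfolding tends_in_def eventually_at dist_real_def
  proof (intro allI impI)
    fix e :: real assume "e > 0"
    then obtain d where "d > 0" "\<forall>q\<in>{s..<s+T}. \<bar>q - t\<bar> < d \<longrightarrow> ?p (u' q - u' t) < e"
      using u'_near[of t e] t by auto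
    then show "\<exists>d>0. \<forall>q\<in>{s<..<s+T}. q \<noteq> t \<and> \<bar>q - t\<bar> < d \<longrightarrow> ?p (u' q - u' t) < e"
      by (intro exI[of _ d]) auto
  qed
  \<comment> \<open>The mean value inequality in the shifted time. It will be used with
    \<open>y = u' t\<close> on an interval on which continuity keeps \<open>u'\<close> close to
    \<open>u' t\<close>.\<close>
  have increment: "?p (u b - u a - (b - a) *\<^sub>R y) \<le> (b - a) * e"
    if "s \<le> a" "a \<le> b" "b < s + T" "y \<in> B astar" "\<And>q. a \<le> q \<Longrightarrow> q \<le> b \<Longrightarrow> ?p (u' q - y) \<le> e" for a b y e
  proof -
    have "?p (A (w q) + Z (w q) - y) \<le> e" if "a - s \<le> q" "q \<le> b - s" for q
      using that \<open>\<And>q. a \<le> q \<Longrightarrow> q \<le> b \<Longrightarrow> ?p (u' q - y) \<le> e\<close>[of "q + s"] by (simp add: u'_def u_def)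
    then have "?p (w (b - s) - w (a - s) - ((b - s) - (a - s)) *\<^sub>R y) \<le> ((b - s) - (a - s)) * e"
      using that by (intro mean_value[where r = "b - s"]) auto
    then show ?thesis by (simp add: u_def)
  qed
  have u_deriv: "tends_in ?p (\<lambda>r. inverse (r - t) *\<^sub>R (u r - u t)) (u' t) (at t)" if t: "t \<in> {s<..<s+T}" for t
    unfolding tends_in_def eventually_at dist_real_def
  proof (intro allI impI)
    fix e :: real assume e: "e > 0"
    have tt: "t \<in> {s..<s+T}" using t by auto
    obtain d where d: "d > 0" "\<And>q. q \<in> {s..<s+T} \<Longrightarrow> \<bar>q - t\<bar> < d \<Longrightarrow> ?p (u' q - u' t) < e / 2"
      using u'_near[OF tt, of "e / 2"] e by auto
    \<comment> \<open>Besides the continuity radius, this keeps \<open>r\<close> inside the open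
      interval on both sides of \<open>t\<close>, as the two-sided limit requires.\<close>
    define d' where "d' = min d (min (t - s) (s + T - t))"
    have "?p (inverse (r - t) *\<^sub>R (u r - u t) - u' t) < e" if r: "r \<noteq> t" "\<bar>r - t\<bar> < d'" for r
    proof -
      have rr: "r \<in> {s..<s+T}" using r t by (auto simp: d'_def)
      have le: "?p (u' q - u' t) \<le> e / 2" if "min r t \<le> q" "q \<le> max r t" for q
        using that r rr tt by (intro less_imp_le d(2)) (auto simp: d'_def)
      note mems = in_B(1)[OF rr] in_B(1)[OF tt] u'_B[OF tt]
      have "?p (u r - u t - (r - t) *\<^sub>R u' t) \<le> \<bar>r - t\<bar> * (e / 2)"
      proof (cases "t \<le> r")
        case True
        then have "?p (u r - u t - (r - t) *\<^sub>R u' t) \<le> (r - t) * (e / 2)"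
          using rr tt mems le by (intro increment) auto
        then show ?thesis using True by simp
      next
        \<comment> \<open>\<open>increment\<close> needs ordered endpoints, so the left difference
          quotient is handled by exchanging \<open>r\<close> and \<open>t\<close> and changing the
          sign.\<close>
        case False
        then have "?p (u t - u r - (t - r) *\<^sub>R u' t) \<le> (t - r) * (e / 2)"
          using rr tt mems le by (intro increment) auto
        moreover have "u r - u t - (r - t) *\<^sub>R u' t = - (u t - u r - (t - r) *\<^sub>R u' t)"
          by (simp add: algebra_simps)
        then have "?p (u r - u t - (r - t) *\<^sub>R u' t) = ?p (u t - u r - (t - r) *\<^sub>R u' t)"
          by (simp only: n_minus mem mems)
        ultimately show ?thesis using False by simp
      qed
      moreover have "u r - u t - (r - t) *\<^sub>R u' t = (r - t) *\<^sub>R (inverse (r - t) *\<^sub>R (u r - u t) - u' t)"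
        using r by (simp add: scaleR_diff_right)
      ultimately have "\<bar>r - t\<bar> * ?p (inverse (r - t) *\<^sub>R (u r - u t) - u' t) \<le> \<bar>r - t\<bar> * (e / 2)"
        using mems by (simp add: n_scale mem)
      then have "?p (inverse (r - t) *\<^sub>R (u r - u t) - u' t) \<le> e / 2"
        using r by (simp add: mult_le_cancel_left)
      then show ?thesis using e by simp
    qed
    moreover have "d' > 0" using d t by (simp add: d'_def)
    ultimately show "\<exists>d>0. \<forall>r\<in>UNIV. r \<noteq> t \<and> \<bar>r - t\<bar> < d \<longrightarrow> ?p (inverse (r - t) *\<^sub>R (u r - u t) - u' t) < e"
      by blast
  qed
  have interior: "t \<in> {s..<s+T}" if "t \<in> {s<..<s+T}" for t using that by simp
  show ?thesis
  proof (rule exI[of _ u], rule conjI[OF _ conjI[OF _ conjI[OF exI[of _ u']]]], goal_cases)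
    case 1
    show ?case using in_B by blast
  next
    case 2
    show ?case using u_cont by blast
  next
    case 3
    show ?case
      by (intro conjI ballI u'_B[OF interior] u_deriv u'_cont in_B(2,3)[OF interior] u'_def)
  next
    case 4
    show ?case by (simp add: u_def w0)
  qed
qed

end
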